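(* Let $p$ be a prime, let $f$ be a positive integer and let $q=p^f$. Let $G=V\rtimes H$ be a primitive subgroup of $\mathrm{A}\Gamma\mathrm{L}_1(q)$, where $V=\mathbb{F}_q$ is the group of translations and $H\le\Gamma\mathrm{L}_1(q)$ is the stabilizer of the zero vector. Suppose that $H$ is nilpotent and let $r$ be the largest prime dividing $|H|$. If $r>2$, then $r$ divides $|H:\langle H^\ast\rangle|$; in particular, $\gamma(G)=2$ and $G$ is basic.
   Context: $\Gamma\mathrm{L}_1(q)=\mathbb{F}_q^\ast\rtimes\mathrm{Aut}(\mathbb{F}_q)$ and $\mathrm{A}\Gamma\mathrm{L}_1(q)=\mathbb{F}_q\rtimes\Gamma\mathrm{L}_1(q)$, acting on $V=\mathbb{F}_q$. The group $G=V\rtimes H$ is primitive (in its action on $V$) if and only if $V$ is an irreducible $\mathbb{F}_pH$-module. The set $H^\ast$ is $\{h\in H\mid vh=v\text{ for some }v\in V\setminus\{0\}\}$, the set of elements of $H$ fixing some nonzero vector of $V$. For a finite group $X$, the normal covering number $\gamma(X)$ is the smallest $k$ such that there are $k$ proper subgroups $H_1,\dots,H_k$ of $X$ with $X=\bigcup_{i=1}^k\bigcup_{x\in X}H_i^x$; if no such $k$ exists then $\gamma(X)\ne 2$. Thus $\gamma(X)=2$ if and only if $X$ is the union of the conjugates of two proper subgroups. A finite group $G$ is called basic (of affine type) if $G$ has a unique minimal normal subgroup $V$, $V$ is abelian, $\gamma(G/V)\neq 2$, and $\gamma(G)=2$. *)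

theory Defs
  imports
    "HOL-Algebra.Algebra"
    "HOL-Library.Extended_Nat"
    "HOL-Computational_Algebra.Primes"
begin

section \<open>Abstract groups\<close>

primrec lower_central :: "('a, 'b) monoid_scheme \<Rightarrow> nat \<Rightarrow> 'a set" where
  "lower_central G 0 = carrier G"
| "lower_central G (Suc n) = generate G
     (\<Union>x\<in>lower_central G n. \<Union>y\<in>carrier G.
        {x \<otimes>\<^bsub>G\<^esub> y \<otimes>\<^bsub>G\<^esub> inv\<^bsub>G\<^esub> x \<otimes>\<^bsub>G\<^esub> inv\<^bsub>G\<^esub> y})"

definition nilpotent_group :: "('a, 'b) monoid_scheme \<Rightarrow> bool" where
  "nilpotent_group G \<longleftrightarrow> group G \<and> (\<exists>n. lower_central G n = {\<one>\<^bsub>G\<^esub>})"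

text \<open>The value is \<open>\<infinity>\<close> (the infimum of the empty set) if no finite family of
  conjugacy classes of proper subgroups covers the group.\<close>

definition normal_covering_number :: "('a, 'b) monoid_scheme \<Rightarrow> enat" where
  "normal_covering_number G =
     (INF k \<in> {k. \<exists>K. (\<forall>i<k. subgroup (K i) G \<and> K i \<noteq> carrier G) \<and>
          carrier G = (\<Union>i<k. \<Union>x\<in>carrier G. inv\<^bsub>G\<^esub> x <#\<^bsub>G\<^esub> K i #>\<^bsub>G\<^esub> x)}. enat k)"

definition minimal_normal_subgroup :: "'a set \<Rightarrow> ('a, 'b) monoid_scheme \<Rightarrow> bool" where
  "minimal_normal_subgroup N G \<longleftrightarrow>
     N \<lhd> G \<and> N \<noteq> {\<one>\<^bsub>G\<^esub>} \<and> (\<forall>M. M \<lhd> G \<and> M \<subseteq> N \<longrightarrow> M = {\<one>\<^bsub>G\<^esub>} \<or> M = N)"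

definition basic_affine_group :: "('a, 'b) monoid_scheme \<Rightarrow> bool" where
  "basic_affine_group G \<longleftrightarrow> group G \<and> finite (carrier G) \<and>
     (\<exists>V. minimal_normal_subgroup V G \<and> (\<forall>N. minimal_normal_subgroup N G \<longrightarrow> N = V) \<and>
        comm_group (G\<lparr>carrier := V\<rparr>) \<and> normal_covering_number (G Mod V) \<noteq> 2) \<and>
     normal_covering_number G = 2"


section \<open>Primitive actions\<close>

definition action_block ::
    "('g, 'm) monoid_scheme \<Rightarrow> 'x set \<Rightarrow> ('g \<Rightarrow> 'x \<Rightarrow> 'x) \<Rightarrow> 'x set \<Rightarrow> bool" where
  "action_block G E \<phi> B \<longleftrightarrow> B \<subseteq> E \<and> B \<noteq> {} \<and>
     (\<forall>g\<in>carrier G. \<phi> g ` B = B \<or> \<phi> g ` B \<inter> B = {})"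

locale primitive_action = transitive_action +
  assumes trivial_blocks: "action_block G E \<phi> B \<Longrightarrow> is_singleton B \<or> B = E"


section \<open>One-dimensional semilinear groups\<close>

definition field_automorphism :: "('a::field \<Rightarrow> 'a) \<Rightarrow> bool" where
  "field_automorphism \<sigma> \<longleftrightarrow> bij \<sigma> \<and> \<sigma> 1 = 1 \<and>
     (\<forall>x y. \<sigma> (x + y) = \<sigma> x + \<sigma> y) \<and> (\<forall>x y. \<sigma> (x * y) = \<sigma> x * \<sigma> y)"

text \<open>The field \<open>F\<^sub>q\<close> is a type \<open>'a::finite_field\<close> with \<open>q\<close> elements, and the subgroups of
  \<open>A\<Gamma>L\<^sub>1(q)\<close> are represented by the sets of permutations of \<open>'a\<close> that they induce. Maps are
  written on the left, so the product is composition.\<close>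

abbreviation perm_group :: "('a \<Rightarrow> 'a) set \<Rightarrow> ('a \<Rightarrow> 'a) monoid" where
  "perm_group S \<equiv> (BijGroup UNIV)\<lparr>carrier := S\<rparr>"

definition GammaL1 :: "('a::finite_field \<Rightarrow> 'a) set" where
  "GammaL1 = {\<lambda>x. a * \<sigma> x | a \<sigma>. a \<noteq> 0 \<and> field_automorphism \<sigma>}"

definition translation_maps :: "('a::finite_field \<Rightarrow> 'a) set" where
  "translation_maps = {\<lambda>x. x + b | b. True}"

definition AGammaL1 :: "('a::finite_field \<Rightarrow> 'a) set" where
  "AGammaL1 = {\<lambda>x. h x + b | h b. h \<in> GammaL1}"

definition fixing_elements :: "('a::finite_field \<Rightarrow> 'a) set \<Rightarrow> ('a \<Rightarrow> 'a) set" where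
  "fixing_elements H = {h \<in> H. \<exists>v. v \<noteq> 0 \<and> h v = v}"

lemma BijGroup_UNIV_simps [simp]:
  "carrier (BijGroup UNIV) = {f. bij f}" "\<one>\<^bsub>BijGroup UNIV\<^esub> = id"
  by (auto simp: BijGroup_def Bij_def restrict_def)

lemma mult_BijGroup_UNIV:
  "bij f \<Longrightarrow> bij g \<Longrightarrow> f \<otimes>\<^bsub>BijGroup UNIV\<^esub> g = f \<circ> g"
  by (auto simp: BijGroup_def Bij_def compose_def restrict_def)

lemma inv_BijGroup_UNIV: "bij f \<Longrightarrow> inv\<^bsub>BijGroup UNIV\<^esub> f = inv_into UNIV f"
  by (rule group.inv_equality[OF group_BijGroup])
     (auto simp: mult_BijGroup_UNIV bij_imp_bij_inv bij_is_inj)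

lemma field_automorphism_inv:
  assumes "field_automorphism \<sigma>"
  shows "field_automorphism (inv_into UNIV \<sigma>)"
proof -
  have b: "bij \<sigma>" and s: "\<sigma> (inv_into UNIV \<sigma> x) = x" for x
    using assms by (auto simp: field_automorphism_def bij_is_surj surj_f_inv_f)
  have eq: "inv_into UNIV \<sigma> x = y" if "\<sigma> y = x" for x y
    using b that by (metis bij_inv_eq_iff)
  show ?thesis
    using assms b unfolding field_automorphism_def
    by (auto intro!: eq simp: s bij_imp_bij_inv)
qed

lemma GammaL1_bij:
  assumes "h \<in> GammaL1" shows "bij h"
proof -
  obtain a \<sigma> where a: "a \<noteq> 0" "bij \<sigma>" "h = (\<lambda>x. a * x) \<circ> \<sigma>"
    using assms by (fastforce simp: GammaL1_def field_automorphism_def o_def)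
  have "bij (\<lambda>x. a * x)"
    using a(1) by (intro o_bij[of "\<lambda>x. x / a"]) auto
  with a show ?thesis by (simp add: bij_comp)
qed

lemma AGammaL1_iff:
  "g \<in> AGammaL1 \<longleftrightarrow> (\<exists>a \<sigma> b. a \<noteq> 0 \<and> field_automorphism \<sigma> \<and> g = (\<lambda>x. a * \<sigma> x + b))"
  by (fastforce simp: AGammaL1_def GammaL1_def)

lemma AGammaL1_bij:
  assumes "g \<in> AGammaL1" shows "bij g"
proof -
  obtain h b where h: "h \<in> GammaL1" "g = (\<lambda>x. x + b) \<circ> h"
    using assms by (fastforce simp: AGammaL1_def o_def)
  have "bij (\<lambda>x. x + b)"
    by (intro o_bij[of "\<lambda>x. x - b"]) auto
  with h show ?thesis by (simp add: bij_comp GammaL1_bij)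
qed

lemma AGammaL1_comp:
  assumes "g \<in> AGammaL1" "h \<in> AGammaL1" shows "g \<circ> h \<in> AGammaL1"
proof -
  obtain a \<sigma> b where g: "a \<noteq> 0" "field_automorphism \<sigma>" "g = (\<lambda>x. a * \<sigma> x + b)"
    using assms(1) by (auto simp: AGammaL1_iff)
  obtain c \<tau> d where h: "c \<noteq> 0" "field_automorphism \<tau>" "h = (\<lambda>x. c * \<tau> x + d)"
    using assms(2) by (auto simp: AGammaL1_iff)
  have "\<sigma> 0 = 0" using g(2) unfolding field_automorphism_def by (metis add_cancel_left_right)
  then have "\<sigma> c \<noteq> 0"
    using g(2) h(1) unfolding field_automorphism_def by (metis bij_is_inj injD)
  moreover have "field_automorphism (\<sigma> \<circ> \<tau>)"
    using g(2) h(2) by (auto simp: field_automorphism_def bij_comp)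
  moreover have "g \<circ> h = (\<lambda>x. (a * \<sigma> c) * (\<sigma> \<circ> \<tau>) x + (a * \<sigma> d + b))"
    using g(2) by (auto simp: g(3) h(3) field_automorphism_def algebra_simps)
  ultimately show ?thesis
    using g(1) unfolding AGammaL1_iff by (metis mult_eq_0_iff)
qed

lemma AGammaL1_inv:
  assumes "g \<in> AGammaL1" shows "inv_into UNIV g \<in> AGammaL1"
proof -
  obtain a \<sigma> b where g: "a \<noteq> 0" "field_automorphism \<sigma>" "g = (\<lambda>x. a * \<sigma> x + b)"
    using assms by (auto simp: AGammaL1_iff)
  define \<tau> where "\<tau> = inv_into UNIV \<sigma>"
  have \<tau>: "field_automorphism \<tau>" "\<tau> 0 = 0" "\<And>x. \<sigma> (\<tau> x) = x"
    using field_automorphism_inv[OF g(2)] g(2)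
    by (auto simp: \<tau>_def field_automorphism_def bij_is_surj surj_f_inv_f)
       (metis add_cancel_left_right)
  have "\<tau> (1 / a) \<noteq> 0"
    using g(1) \<tau> by (metis divide_eq_0_iff one_neq_zero)
  moreover have "inv_into UNIV g = (\<lambda>x. \<tau> (1 / a) * \<tau> x + \<tau> (- b / a))"
  proof
    fix x
    have "\<tau> (1 / a) * \<tau> x + \<tau> (- b / a) = \<tau> ((x - b) / a)"
      using \<tau>(1) unfolding field_automorphism_def
      by (metis (no_types, opaque_lifting) add_divide_distrib diff_conv_add_uminus mult.left_neutral times_divide_eq_left)
    moreover have "g (\<tau> ((x - b) / a)) = x"
      using g(1) \<tau>(3) by (simp add: g(3))
    ultimately show "inv_into UNIV g x = \<tau> (1 / a) * \<tau> x + \<tau> (- b / a)"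
      using AGammaL1_bij[OF assms] by (metis bij_inv_eq_iff)
  qed
  ultimately show ?thesis
    using \<tau>(1) unfolding AGammaL1_iff by blast
qed

lemma subgroup_AGammaL1: "subgroup AGammaL1 (BijGroup UNIV)"
proof (rule group.subgroupI[OF group_BijGroup])
  have "id \<in> AGammaL1"
    unfolding AGammaL1_iff
    by (intro exI[of _ 1] exI[of _ id] exI[of _ 0]) (auto simp: field_automorphism_def)
  then show "AGammaL1 \<noteq> {}" by blast
qed (auto simp: mult_BijGroup_UNIV inv_BijGroup_UNIV AGammaL1_bij AGammaL1_comp AGammaL1_inv)

lemma stabilizer_AGammaL1: "stabilizer (perm_group AGammaL1) id 0 = GammaL1"
proof -
  have "\<sigma> 0 = 0" if "field_automorphism \<sigma>" for \<sigma> :: "'a \<Rightarrow> 'a"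
    using that unfolding field_automorphism_def by (metis add_cancel_left_right)
  then have z: "h 0 = 0" if "h \<in> GammaL1" for h :: "'a \<Rightarrow> 'a"
    using that by (auto simp: GammaL1_def)
  show ?thesis
  proof (intro Set.set_eqI iffI)
    fix g :: "'a \<Rightarrow> 'a"
    assume "g \<in> stabilizer (perm_group AGammaL1) id 0"
    then obtain h b where "h \<in> GammaL1" "g = (\<lambda>x. h x + b)" "g 0 = 0"
      by (auto simp: stabilizer_def AGammaL1_def)
    then show "g \<in> GammaL1" using z[of h] by simp
  next
    fix g :: "'a \<Rightarrow> 'a"
    assume g: "g \<in> GammaL1"
    then have "g \<in> AGammaL1"
      unfolding AGammaL1_def by (intro CollectI exI[of _ g] exI[of _ 0]) simp
    with z[OF g] show "g \<in> stabilizer (perm_group AGammaL1) id 0"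
      by (simp add: stabilizer_def)
  qed
qed

lemma group_action_perm_group:
  assumes "subgroup G (perm_group AGammaL1)"
  shows "group_action (perm_group G) UNIV id"
proof -
  have "subgroup G (BijGroup UNIV)"
    using group.incl_subgroup[OF group_BijGroup subgroup_AGammaL1 assms] .
  then have "group (perm_group G)" "G \<subseteq> carrier (BijGroup UNIV)"
    using subgroup.subgroup_is_group[OF _ group_BijGroup] subgroup.subset by blast+
  then show ?thesis
    by (auto simp: group_action_def group_hom_def group_hom_axioms_def hom_def group_BijGroup)
qed

end

theory Submission
  imports Defs "HOL-Number_Theory.Residues" "HOL-Computational_Algebra.Polynomial"
begin

text \<open>
  Write \<open>H = R \<times> K\<close> with \<open>R\<close> the Sylow \<open>r\<close>-subgroup. An element of \<open>H\<close> fixing a vector has an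
  \<open>R\<close>-component fixing that vector, so it suffices to find a proper subgroup of \<open>R\<close> that contains
  every element of \<open>R\<close> with a nonzero fixed vector. By irreducibility, a central element \<open>z \<noteq> 1\<close> of
  \<open>R\<close> fixes no nonzero vector, since its fixed vectors form an \<open>H\<close>-submodule. The group of field
  automorphisms induced by \<open>R\<close> is cyclic of order \<open>r ^ k\<close>. If no element with a fixed vector induces
  a generator, the preimage of the subgroup of index \<open>r\<close> will do. Otherwise \<open>R = R\<^sub>0\<langle>x\<rangle>\<close>, where
  \<open>R\<^sub>0\<close> consists of the multiplications in \<open>R\<close> and \<open>x\<close> has order \<open>r ^ k\<close> and fixes a vector \<open>w\<close>;
  after scaling, \<open>x\<close> is the map \<open>v \<mapsto> v ^ q\<^sub>0\<close>. For \<open>k > 0\<close> the power \<open>x ^ (r ^ (k - 1))\<close> is not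
  central, which forces \<open>r dvd q\<^sub>0 - 1\<close> and then that \<open>R\<^sub>0\<close> contains elements of order greater than
  \<open>r ^ k\<close>. On the other hand, if \<open>c x ^ m\<close> fixes a vector then \<open>c\<close> has norm \<open>1\<close>, and because \<open>r\<close> is
  odd the norm exponent \<open>\<Sum>i<r ^ k. (q\<^sub>0 ^ m) ^ i\<close> has \<open>r\<close>-part exactly \<open>r ^ k\<close>, so \<open>c ^ (r ^ k) = 1\<close>.
  Hence the elements \<open>c x ^ m\<close> with \<open>c ^ (r ^ k) = 1\<close> form the required proper subgroup.

  An element \<open>g\<close> of \<open>G\<close> whose linear part has no nonzero fixed vector fixes a point, so \<open>G\<close> is covered by the
  conjugates of \<open>H\<close> and of \<open>V\<langle>H\<^sup>*\<rangle>\<close>. The quotient \<open>G / V\<close> is nilpotent, so its proper subgroups lie in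
  proper normal subgroups, and no group is the union of two proper subgroups.
\<close>

section \<open>Nilpotent groups and coverings\<close>

text \<open>A nonempty set in a well-order attains its infimum, and a finite value excludes the
  empty set. This extracts an actual covering from an equation about
  \<open>normal_covering_number\<close>.\<close>

lemma Inf_enat_mem:
  assumes "Inf (enat ` S) = enat n"
  shows "n \<in> S"
proof -
  have "S \<noteq> {}" using assms by (auto simp: top_enat_def)
  then obtain x where "x \<in> enat ` S" by blast
  then have "Inf (enat ` S) \<in> enat ` S" by (rule wellorder_InfI)
  with assms show ?thesis by auto
qed

context group
begin

lemma mult_inv_cancel [simp]:
  assumes "x \<in> carrier G" "y \<in> carrier G"
  shows "x \<otimes> (inv x \<otimes> y) = y" "inv x \<otimes> (x \<otimes> y) = y"
  using assms by (simp_all flip: m_assoc)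

text \<open>Conjugation sends a commutator to the commutator of the conjugates, so normality passes
  from each term of the series to the next.\<close>

lemma lower_central_normal: "lower_central G n \<lhd> G"
proof (induction n)
  case 0
  then show ?case by (simp add: normal_self)
next
  case (Suc n)
  let ?S = "\<Union>x\<in>lower_central G n. \<Union>y\<in>carrier G. {x \<otimes> y \<otimes> inv x \<otimes> inv y}"
  have sub: "lower_central G n \<subseteq> carrier G"
    using Suc normal_imp_subgroup subgroup.subset by blast
  have "generate G ?S \<lhd> G"
  proof (rule normal_generateI)
    show "?S \<subseteq> carrier G" using sub by auto
  next
    fix h g
    assume "h \<in> ?S" and g: "g \<in> carrier G"
    then obtain x y where x: "x \<in> lower_central G n" and y: "y \<in> carrier G"
      and h: "h = x \<otimes> y \<otimes> inv x \<otimes> inv y" by auto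
    have xc: "x \<in> carrier G" using x sub by auto
    let ?x = "g \<otimes> x \<otimes> inv g" and ?y = "g \<otimes> y \<otimes> inv g"
    have "g \<otimes> h \<otimes> inv g = ?x \<otimes> ?y \<otimes> inv ?x \<otimes> inv ?y"
      using g xc y by (simp add: h m_assoc inv_mult_group)
    moreover have "?x \<in> lower_central G n" "?y \<in> carrier G"
      using normal.inv_op_closed2[OF Suc g x] g y by auto
    ultimately show "g \<otimes> h \<otimes> inv g \<in> ?S" by blast
  qed
  then show ?case by simp
qed

lemma lower_central_subset: "lower_central G n \<subseteq> carrier G"
  using lower_central_normal normal_imp_subgroup subgroup.subset by blast

lemma commutator_in_lower_central:
  assumes "x \<in> lower_central G n" "y \<in> carrier G"
  shows "x \<otimes> y \<otimes> inv x \<otimes> inv y \<in> lower_central G (Suc n)"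
  using assms by (auto intro!: generate.incl)

text \<open>Take \<open>M = K \<gamma>\<^sub>i\<close> for the least \<open>i\<close> with \<open>K \<gamma>\<^sub>i \<noteq> G\<close>: it is normalised by \<open>K\<close> and by
  \<open>\<gamma>\<^sub>i\<^sub>-\<^sub>1\<close>, which together generate \<open>G\<close>.\<close>

lemma nilpotent_proper_subgroup_in_proper_normal:
  assumes nil: "nilpotent_group G" and K: "subgroup K G" "K \<noteq> carrier G"
  shows "\<exists>M. M \<lhd> G \<and> K \<subseteq> M \<and> M \<noteq> carrier G"
proof -
  obtain n where n: "lower_central G n = {\<one>}"
    using nil by (auto simp: nilpotent_group_def)
  have sub: "K \<subseteq> carrier G" using K by (simp add: subgroup.subset)
  define P where "P i \<longleftrightarrow> K <#> lower_central G i \<noteq> carrier G" for i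
  have "K <#> {\<one>} = K" using sub by (force simp: set_mult_def)
  then have "P n" using n K by (simp add: P_def)
  define i where "i = (LEAST i. P i)"
  have "P i" unfolding i_def using \<open>P n\<close> by (rule LeastI)
  have "K <#> carrier G = carrier G"
  proof
    show "carrier G \<subseteq> K <#> carrier G"
      using subgroup.one_closed[OF K(1)] by (force simp: set_mult_def)
  qed (use sub in \<open>auto simp: set_mult_def\<close>)
  then have "\<not> P 0" by (simp add: P_def)
  then obtain j where j: "i = Suc j" using \<open>P i\<close> by (cases i) auto
  have "\<not> P j" using not_less_Least[of j P] j i_def by simp
  then have full: "K <#> lower_central G j = carrier G" by (simp add: P_def)
  let ?M = "K <#> lower_central G i"
  have M: "subgroup ?M G"
    using commut_normal[OF K(1) lower_central_normal]
      normal.intro lower_central_normal mult_norm_subgroup[OF _ K(1)] by metis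
  have KM: "k \<in> ?M" if "k \<in> K" for k
    using that sub subgroup.one_closed[OF normal_imp_subgroup[OF lower_central_normal]]
    by (force simp: set_mult_def)
  have ZM: "z \<in> ?M" if "z \<in> lower_central G i" for z
    using that lower_central_subset subgroup.one_closed[OF K(1)]
    by (force simp: set_mult_def)
  have "?M \<lhd> G"
  proof (rule normal_invI[OF M])
    fix g h
    assume g: "g \<in> carrier G" and h: "h \<in> ?M"
    obtain k' z' where k': "k' \<in> K" and z': "z' \<in> lower_central G j" and gd: "g = k' \<otimes> z'"
      using g[folded full] by (auto simp: set_mult_def)
    obtain k z where k: "k \<in> K" and z: "z \<in> lower_central G i" and hd: "h = k \<otimes> z"
      using h by (auto simp: set_mult_def)
    have c: "k' \<in> carrier G" "z' \<in> carrier G" "k \<in> carrier G" "z \<in> carrier G"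
      using k k' z z' sub lower_central_subset by auto
    \<comment> \<open>Between \<open>k'\<close> and its inverse stand a commutator from
      \<open>lower_central G (Suc j)\<close>, an element of \<open>K\<close> and a conjugate of
      \<open>z\<close>; all of them lie in \<open>?M\<close>, and so does \<open>k'\<close>.\<close>
    have eq: "g \<otimes> h \<otimes> inv g =
        k' \<otimes> ((z' \<otimes> k \<otimes> inv z' \<otimes> inv k) \<otimes> k \<otimes> (z' \<otimes> z \<otimes> inv z')) \<otimes> inv k'"
      using c by (simp add: gd hd m_assoc inv_mult_group)
    have "z' \<otimes> k \<otimes> inv z' \<otimes> inv k \<in> ?M"
      using commutator_in_lower_central[OF z' c(3)] j ZM by auto
    moreover have "z' \<otimes> z \<otimes> inv z' \<in> ?M"
      using normal.inv_op_closed2[OF lower_central_normal c(2) z] ZM by auto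
    ultimately show "g \<otimes> h \<otimes> inv g \<in> ?M"
      unfolding eq using KM[OF k] KM[OF k']
      by (meson subgroup.m_closed[OF M] subgroup.m_inv_closed[OF M])
  qed
  with \<open>P i\<close> KM show ?thesis unfolding P_def by blast
qed

text \<open>Since \<open>c\<close> commutes with \<open>x\<close> and \<open>y\<close>, each passage
  of an \<open>x\<close> past a \<open>y\<close> costs one factor \<open>c\<close>. Moving
  \<open>x [^] m = \<one>\<close> past \<open>y\<close> gives \<open>c [^] m = \<one>\<close>, and
  symmetrically \<open>c [^] l = \<one>\<close>.\<close>

lemma central_commutator_coprime:
  assumes c: "x \<in> carrier G" "y \<in> carrier G" "c \<in> carrier G"
    and comm: "c \<otimes> x = x \<otimes> c" "c \<otimes> y = y \<otimes> c"
    and xy: "x \<otimes> y = c \<otimes> (y \<otimes> x)"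
    and ord: "x [^] m = \<one>" "y [^] l = \<one>" "coprime m (l::nat)"
  shows "c = \<one>"
proof -
  have 1: "x [^] (i::nat) \<otimes> y = c [^] i \<otimes> (y \<otimes> x [^] i)" for i
  proof (induction i)
    case (Suc i)
    have ci: "c [^] i \<otimes> x = x \<otimes> c [^] i"
      using c comm by (metis group_commutes_pow)
    have "x [^] Suc i \<otimes> y = x \<otimes> (x [^] i \<otimes> y)"
      using c by (metis m_assoc nat_pow_Suc2 nat_pow_closed)
    also have "\<dots> = x \<otimes> c [^] i \<otimes> (y \<otimes> x [^] i)"
      using c by (simp add: Suc m_assoc)
    also have "\<dots> = c [^] i \<otimes> (x \<otimes> y) \<otimes> x [^] i"
      using c by (simp add: ci[symmetric] m_assoc)
    also have "\<dots> = c [^] i \<otimes> c \<otimes> (y \<otimes> (x \<otimes> x [^] i))"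
      using c by (simp add: xy m_assoc)
    finally show ?case
      using c by (metis nat_pow_Suc nat_pow_Suc2)
  qed (use c in simp)
  have 2: "x \<otimes> y [^] (i::nat) = c [^] i \<otimes> (y [^] i \<otimes> x)" for i
  proof (induction i)
    case (Suc i)
    have ci: "c \<otimes> y [^] i = y [^] i \<otimes> c"
      using c comm by (metis group_commutes_pow)
    have "x \<otimes> y [^] Suc i = c [^] i \<otimes> (y [^] i \<otimes> (x \<otimes> y))"
      using c Suc by (simp flip: m_assoc)
    also have "\<dots> = c [^] i \<otimes> ((y [^] i \<otimes> c) \<otimes> (y \<otimes> x))"
      using c by (simp add: xy m_assoc)
    also have "\<dots> = c [^] Suc i \<otimes> (y [^] Suc i \<otimes> x)"
      using c by (simp add: m_assoc flip: ci)
    finally show ?case .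
  qed (use c in simp)
  have "c [^] m = \<one>"
    using 1[of m] c ord(1) by (metis l_one m_closed nat_pow_closed r_cancel_one r_one)
  moreover have "c [^] l = \<one>"
    using 2[of l] c ord(2) by (metis l_one m_closed nat_pow_closed r_cancel_one r_one)
  ultimately have "ord c dvd m" "ord c dvd l"
    using c pow_eq_id by auto
  then have "ord c = 1"
    using ord(3) by (metis coprime_common_divisor_nat nat_dvd_1_iff_1 coprime_common_divisor)
  then show ?thesis using ord_eq_1[OF c(3)] by simp
qed

text \<open>If the commutator of \<open>x\<close> and \<open>y\<close> lies in a term of the lower central series, it is central
  modulo the next term, so there its order divides both \<open>m\<close> and \<open>l\<close>.\<close>

lemma nilpotent_coprime_commute:
  assumes nil: "nilpotent_group G" and xy: "x \<in> carrier G" "y \<in> carrier G"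
    and ord: "x [^] m = \<one>" "y [^] l = \<one>" "coprime m (l::nat)"
  shows "x \<otimes> y = y \<otimes> x"
proof -
  obtain n where n: "lower_central G n = {\<one>}"
    using nil by (auto simp: nilpotent_group_def)
  let ?c = "x \<otimes> y \<otimes> inv x \<otimes> inv y"
  have c: "?c \<in> carrier G" using xy by simp
  have "?c \<in> lower_central G i" for i
  proof (induction i)
    case (Suc i)
    define N where "N = lower_central G (Suc i)"
    let ?h = "\<lambda>g. N #> g"
    interpret N: normal N G unfolding N_def by (rule lower_central_normal)
    interpret Q: group "G Mod N" by (rule N.factorgroup_is_group)
    interpret h: group_hom G "G Mod N" ?h
      by (unfold_locales) (rule N.r_coset_hom_Mod)
    have eq1: "?h a = ?h b" if "a \<otimes> inv b \<in> N" "a \<in> carrier G" "b \<in> carrier G" for a b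
      using that by (intro repr_independence[OF N.rcos_module_rev[OF is_group] _ N.subgroup_axioms, symmetric])
    have com: "?h ?c \<otimes>\<^bsub>G Mod N\<^esub> ?h g = ?h g \<otimes>\<^bsub>G Mod N\<^esub> ?h ?c" if g: "g \<in> carrier G" for g
    proof -
      have "?h (?c \<otimes> g) = ?h (g \<otimes> ?c)"
        using commutator_in_lower_central[OF Suc g, folded N_def] g c
        by (intro eq1) (simp_all add: m_assoc inv_mult_group)
      then show ?thesis using g c by (simp only: h.hom_mult)
    qed
    have "?h ?c = \<one>\<^bsub>G Mod N\<^esub>"
    proof (rule Q.central_commutator_coprime)
      show "?h x \<otimes>\<^bsub>G Mod N\<^esub> ?h y = ?h ?c \<otimes>\<^bsub>G Mod N\<^esub> (?h y \<otimes>\<^bsub>G Mod N\<^esub> ?h x)"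
      proof -
        have "x \<otimes> y = ?c \<otimes> (y \<otimes> x)" using xy by (simp add: m_assoc)
        then show ?thesis using xy c by (simp only: h.hom_mult[symmetric] m_closed)
      qed
      show "?h x [^]\<^bsub>G Mod N\<^esub> m = \<one>\<^bsub>G Mod N\<^esub>" "?h y [^]\<^bsub>G Mod N\<^esub> l = \<one>\<^bsub>G Mod N\<^esub>"
        using ord xy by (metis h.hom_nat_pow h.hom_one)+
    qed (use com xy c ord in \<open>simp_all only: h.hom_closed\<close>)
    then have "?h ?c = N" by simp
    then have "?c \<in> N" using coset_join1[OF _ c N.subgroup_axioms] by simp
    then show ?case unfolding N_def .
  qed (use xy in simp)
  then have "?c = \<one>" using n by blast
  then have "x \<otimes> y \<otimes> inv x \<otimes> inv y \<otimes> (y \<otimes> x) = y \<otimes> x"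
    using xy by (simp only: l_one m_closed)
  moreover have "x \<otimes> y \<otimes> inv x \<otimes> inv y \<otimes> (y \<otimes> x) = x \<otimes> y"
    using xy by (simp add: m_assoc)
  ultimately show ?thesis by metis
qed

lemma nilpotent_covering_number_neq_2:
  assumes nil: "nilpotent_group G"
  shows "normal_covering_number G \<noteq> 2"
proof
  assume eq: "normal_covering_number G = 2"
  let ?S = "{k::nat. \<exists>K. (\<forall>i<k. subgroup (K i) G \<and> K i \<noteq> carrier G) \<and>
          carrier G = (\<Union>i<k. \<Union>x\<in>carrier G. inv x <# K i #> x)}"
  have "Inf (enat ` ?S) = enat 2"
    using eq unfolding normal_covering_number_def numeral_eq_enat by simp
  from Inf_enat_mem[OF this] have "2 \<in> ?S" .
  then obtain K where K: "\<And>i. i < 2 \<Longrightarrow> subgroup (K i) G \<and> K i \<noteq> carrier G"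
    and cov: "carrier G = (\<Union>i<2::nat. \<Union>x\<in>carrier G. inv x <# K i #> x)" by auto
  have "\<exists>M. M \<lhd> G \<and> K i \<subseteq> M \<and> M \<noteq> carrier G" if "i < 2" for i
    using nilpotent_proper_subgroup_in_proper_normal[OF nil] K[OF that] by blast
  then obtain M where M: "\<And>i. i < 2 \<Longrightarrow> M i \<lhd> G \<and> K i \<subseteq> M i \<and> M i \<noteq> carrier G" by metis
  have sg: "subgroup (M i) G" "M i \<subseteq> carrier G" if "i < 2" for i
    using M[OF that] normal_imp_subgroup subgroup.subset by blast+
  \<comment> \<open>Normality of \<open>M i\<close> absorbs all conjugates of \<open>K i\<close>, so
    the covering turns into a union of two proper subgroups.\<close>
  have cov': "g \<in> M 0 \<or> g \<in> M 1" if "g \<in> carrier G" for g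
  proof -
    obtain i x where i: "i < 2" "x \<in> carrier G" "g \<in> inv x <# K i #> x" using cov \<open>g \<in> carrier G\<close> by blast
    then obtain k where k: "k \<in> K i" "g = inv x \<otimes> k \<otimes> x" by (auto simp: l_coset_def r_coset_def)
    have "k \<in> M i" using M[OF i(1)] k by auto
    then have "g \<in> M i" using M[OF i(1)] i(2) k(2) normal.inv_op_closed1 by metis
    moreover have "i = 0 \<or> i = 1" using i by auto
    ultimately show ?thesis by auto
  qed
  \<comment> \<open>\<open>a\<close> lies only in \<open>M 1\<close> and \<open>b\<close> only in
    \<open>M 0\<close>. Whichever of the two contains \<open>a \<otimes> b\<close> would then
    contain the other factor as well.\<close>
  obtain a where a: "a \<in> carrier G" "a \<notin> M 0" using M[of 0] sg(2)[of 0] by auto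
  obtain b where b: "b \<in> carrier G" "b \<notin> M 1" using M[of 1] sg(2)[of 1] by auto
  have a1: "a \<in> M 1" and b0: "b \<in> M 0" using a b cov' by auto
  have "a \<otimes> b \<in> M 0 \<or> a \<otimes> b \<in> M 1" using a b cov' by simp
  then show False
  proof
    assume "a \<otimes> b \<in> M 0"
    then have "a \<otimes> b \<otimes> inv b \<in> M 0"
      using b0 sg(1)[of 0] subgroup.m_closed subgroup.m_inv_closed by (metis zero_less_numeral)
    then show False using a b by (simp add: m_assoc)
  next
    assume "a \<otimes> b \<in> M 1"
    then have "inv a \<otimes> (a \<otimes> b) \<in> M 1"
      using a1 sg(1)[of 1] subgroup.m_closed subgroup.m_inv_closed by (metis one_less_numeral_iff semiring_norm(76))
    then show False using a b by simp
  qed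
qed

section \<open>Hall subgroups and Sylow complements in nilpotent groups\<close>

lemma commuting_subgroups_product:
  assumes K: "subgroup K G" and L: "subgroup L G"
    and comm: "\<And>x y. x \<in> K \<Longrightarrow> y \<in> L \<Longrightarrow> x \<otimes> y = y \<otimes> x"
  shows "subgroup (K <#> L) G"
proof (rule subgroupI)
  have sub: "K \<subseteq> carrier G" "L \<subseteq> carrier G" using K L subgroup.subset by auto
  show "K <#> L \<subseteq> carrier G" using sub by (rule set_mult_closed)
  show "K <#> L \<noteq> {}" using subgroup.one_closed[OF K] subgroup.one_closed[OF L] by (auto simp: set_mult_def)
  show "inv a \<in> K <#> L" if a: "a \<in> K <#> L" for a
  proof -
    obtain x y where xy: "x \<in> K" "y \<in> L" "a = x \<otimes> y" using a by (auto simp: set_mult_def)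
    have "inv x \<in> K" "inv y \<in> L" using xy K L by (simp_all add: subgroup.m_inv_closed)
    moreover from this have "inv a = inv x \<otimes> inv y"
      using comm[OF \<open>inv x \<in> K\<close> \<open>inv y \<in> L\<close>] xy sub by (simp add: inv_mult_group subset_iff)
    ultimately show ?thesis by (auto simp: set_mult_def)
  qed
  show "a \<otimes> b \<in> K <#> L" if ab: "a \<in> K <#> L" "b \<in> K <#> L" for a b
  proof -
    obtain x y where xy: "x \<in> K" "y \<in> L" "a = x \<otimes> y" using ab by (auto simp: set_mult_def)
    obtain u v where uv: "u \<in> K" "v \<in> L" "b = u \<otimes> v" using ab by (auto simp: set_mult_def)
    have c: "x \<in> carrier G" "y \<in> carrier G" "u \<in> carrier G" "v \<in> carrier G"
      using xy uv sub by auto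
    have "a \<otimes> b = x \<otimes> (y \<otimes> u) \<otimes> v" using xy uv c by (simp add: m_assoc)
    also have "\<dots> = (x \<otimes> u) \<otimes> (y \<otimes> v)" using c by (simp add: m_assoc comm[OF uv(1) xy(2), symmetric])
    finally show ?thesis
      using subgroup.m_closed[OF K xy(1) uv(1)] subgroup.m_closed[OF L xy(2) uv(2)]
      by (auto simp: set_mult_def)
  qed
qed

lemma card_set_mult_trivial_Int:
  assumes K: "subgroup K G" and L: "subgroup L G" and "K \<inter> L = {\<one>}"
  shows "card (K <#> L) = card K * card L"
proof -
  have inj: "inj_on (\<lambda>(x, y). x \<otimes> y) (K \<times> L)"
  proof (rule inj_onI, clarify)
    fix a b c d
    assume m: "a \<in> K" "b \<in> L" "c \<in> K" "d \<in> L" and eq: "a \<otimes> b = c \<otimes> d"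
    have car: "a \<in> carrier G" "b \<in> carrier G" "c \<in> carrier G" "d \<in> carrier G"
      using m K L subgroup.mem_carrier by metis+
    have "inv c \<otimes> a = d \<otimes> inv b"
      using car eq by (metis inv_closed inv_solve_left inv_solve_right m_assoc m_closed)
    moreover have "inv c \<otimes> a \<in> K" "d \<otimes> inv b \<in> L"
      using m K L by (simp_all add: subgroup.m_closed subgroup.m_inv_closed)
    ultimately have "inv c \<otimes> a = \<one>" "d \<otimes> inv b = \<one>" using assms(3) by auto
    then show "a = c \<and> b = d" using car
      by (metis inv_closed inv_equality inv_inv inv_solve_right l_one)
  qed
  have "K <#> L = (\<lambda>(x, y). x \<otimes> y) ` (K \<times> L)" by (auto simp: set_mult_def)
  then show ?thesis using card_image[OF inj] by (simp add: card_cartesian_product)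
qed

lemma subgroup_pow_card:
  assumes "subgroup K G" "finite (carrier G)" "x \<in> K"
  shows "x [^] card K = \<one>"
proof -
  interpret K: group "G\<lparr>carrier := K\<rparr>" using assms(1) by (rule subgroup_imp_group)
  have "x [^]\<^bsub>G\<lparr>carrier := K\<rparr>\<^esub> Coset.order (G\<lparr>carrier := K\<rparr>) = \<one>\<^bsub>G\<lparr>carrier := K\<rparr>\<^esub>"
    using assms K.pow_order_eq_1 by simp
  then show ?thesis by (simp add: Coset.order_def nat_pow_consistent[symmetric])
qed

lemma coprime_subgroups_Int:
  assumes "subgroup K G" "subgroup L G" "finite (carrier G)" "coprime (card K) (card L)"
  shows "K \<inter> L = {\<one>}"
proof -
  have "x = \<one>" if "x \<in> K" "x \<in> L" for x
  proof -
    have x: "x \<in> carrier G" using that assms subgroup.mem_carrier by metis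
    have "ord x dvd card K" "ord x dvd card L"
      using x that assms subgroup_pow_card pow_eq_id by metis+
    then have "ord x = 1" using assms(4) coprime_common_divisor by (metis is_unit_gcd_iff nat_dvd_1_iff_1)
    then show ?thesis using ord_eq_1[OF x] by simp
  qed
  then show ?thesis using assms(1,2) subgroup.one_closed by fastforce
qed

text \<open>One Sylow subgroup is adjoined at a time. By nilpotency, elements of coprime orders
  commute, so the product set is a subgroup; coprimality makes the intersection trivial, so the
  orders multiply.\<close>

lemma nilpotent_Hall_subgroup:
  assumes nil: "nilpotent_group G" and fin: "finite (carrier G)"
    and "finite S" "\<And>s. s \<in> S \<Longrightarrow> Factorial_Ring.prime s"
  shows "\<exists>K. subgroup K G \<and> card K = (\<Prod>s\<in>S. s ^ multiplicity s (Coset.order G))"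
  using assms(3,4)
proof (induction S rule: finite_induct)
  case empty
  then show ?case using triv_subgroup by force
next
  case (insert s S)
  then obtain K where K: "subgroup K G" "card K = (\<Prod>s\<in>S. s ^ multiplicity s (Coset.order G))" by auto
  have s: "Factorial_Ring.prime s" using insert by auto
  obtain m where m: "Coset.order G = s ^ multiplicity s (Coset.order G) * m"
    using multiplicity_dvd by (metis dvdE)
  obtain L where L: "subgroup L G" "card L = s ^ multiplicity s (Coset.order G)"
    using sylow_thm[OF s is_group m fin] by auto
  have cop: "coprime (card K) (card L)"
    unfolding K L
  proof (rule prod_coprime_left)
    fix t assume "t \<in> S"
    then have "coprime t s" using insert s by (intro primes_coprime) auto
    then show "coprime (t ^ multiplicity t (Coset.order G)) (s ^ multiplicity s (Coset.order G))" by simp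
  qed
  have comm: "x \<otimes> y = y \<otimes> x" if "x \<in> K" "y \<in> L" for x y
    by (rule nilpotent_coprime_commute[OF nil _ _ subgroup_pow_card subgroup_pow_card cop])
       (use that K(1) L(1) fin in \<open>auto intro: subgroup.mem_carrier\<close>)
  have "card (K <#> L) = card K * card L"
    using card_set_mult_trivial_Int coprime_subgroups_Int K(1) L(1) fin cop by blast
  moreover have "subgroup (K <#> L) G"
    using commuting_subgroups_product[OF K(1) L(1) comm] .
  ultimately show ?case
    using insert K L by (auto simp: mult.commute)
qed

text \<open>\<open>K\<close> is the Hall subgroup for the prime divisors other than
  \<open>r\<close>. The product of the two orders is the full prime factorization of the group
  order, so the product set is the whole group.\<close>

lemma nilpotent_Sylow_complement:
  assumes nil: "nilpotent_group G" and fin: "finite (carrier G)"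
    and r: "Factorial_Ring.prime r"
  obtains R K where "subgroup R G" "subgroup K G" "card R = r ^ multiplicity r (Coset.order G)"
    "carrier G = R <#> K" "R \<inter> K = {\<one>}" "coprime (card R) (card K)"
    "\<And>x y. x \<in> R \<Longrightarrow> y \<in> K \<Longrightarrow> x \<otimes> y = y \<otimes> x"
proof -
  let ?n = "Coset.order G"
  have n0: "?n \<noteq> 0" using fin order_gt_0_iff_finite by simp
  obtain R where R: "subgroup R G" "card R = r ^ multiplicity r ?n"
    using nilpotent_Hall_subgroup[OF nil fin, of "{r}"] r by auto
  obtain K where K: "subgroup K G"
    "card K = (\<Prod>s\<in>prime_factors ?n - {r}. s ^ multiplicity s ?n)"
    using nilpotent_Hall_subgroup[OF nil fin, of "prime_factors ?n - {r}"] by auto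
  have cop: "coprime (card R) (card K)"
    unfolding K R
  proof (rule prod_coprime_right)
    fix s assume "s \<in> prime_factors ?n - {r}"
    then have "coprime r s" using r by (intro primes_coprime) auto
    then show "coprime (r ^ multiplicity r ?n) (s ^ multiplicity s ?n)" by simp
  qed
  have Int: "R \<inter> K = {\<one>}" using coprime_subgroups_Int R(1) K(1) fin cop by blast
  have comm: "x \<otimes> y = y \<otimes> x" if "x \<in> R" "y \<in> K" for x y
    by (rule nilpotent_coprime_commute[OF nil _ _ subgroup_pow_card subgroup_pow_card cop])
       (use that K(1) R(1) fin in \<open>auto intro: subgroup.mem_carrier\<close>)
  have "card R * card K = (\<Prod>s\<in>prime_factors ?n. s ^ multiplicity s ?n)"
  proof (cases "r \<in> prime_factors ?n")
    case True
    then show ?thesis unfolding K R by (subst prod.remove[of _ r]) auto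
  next
    case False
    then have "multiplicity r ?n = 0"
      using r n0 by (metis not_dvd_imp_multiplicity_0 prime_factorsI)
    then show ?thesis using False unfolding K R by simp
  qed
  also have "\<dots> = ?n" using n0 prime_factorization_nat[of ?n] by simp
  finally have "card (R <#> K) = ?n"
    using card_set_mult_trivial_Int[OF R(1) K(1) Int] by simp
  moreover have "R <#> K \<subseteq> carrier G"
    using R(1) K(1) set_mult_closed subgroup.subset by metis
  ultimately have "carrier G = R <#> K"
    using card_subset_eq[OF fin, of "R <#> K"] by (simp add: Coset.order_def)
  with that R K Int comm cop show thesis by blast
qed

end

section \<open>Nilpotency of homomorphic images\<close>

lemma (in group_hom) lower_central_image:
  assumes surj: "h ` carrier G = carrier H"
  shows "lower_central H n = h ` lower_central G n"
proof (induction n)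
  case (Suc n)
  let ?S = "\<Union>x\<in>lower_central G n. \<Union>y\<in>carrier G. {x \<otimes> y \<otimes> inv x \<otimes> inv y}"
  have sub: "lower_central G n \<subseteq> carrier G" by (rule G.lower_central_subset)
  have img: "h ` ?S = (\<Union>x\<in>lower_central H n. \<Union>y\<in>carrier H.
      {x \<otimes>\<^bsub>H\<^esub> y \<otimes>\<^bsub>H\<^esub> inv\<^bsub>H\<^esub> x \<otimes>\<^bsub>H\<^esub> inv\<^bsub>H\<^esub> y})"
  proof -
    have "h (x \<otimes> y \<otimes> inv x \<otimes> inv y) =
        h x \<otimes>\<^bsub>H\<^esub> h y \<otimes>\<^bsub>H\<^esub> inv\<^bsub>H\<^esub> h x \<otimes>\<^bsub>H\<^esub> inv\<^bsub>H\<^esub> h y"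
      if "x \<in> lower_central G n" "y \<in> carrier G" for x y
      using that sub by (simp add: subset_iff)
    then show ?thesis unfolding Suc surj[symmetric] by (simp add: image_UN)
  qed
  have "?S \<subseteq> carrier G" using sub by auto
  from generate_img[OF this] show ?case unfolding img by simp
qed (use surj in simp)

lemma (in group_hom) nilpotent_image:
  assumes "nilpotent_group G" and surj: "h ` carrier G = carrier H"
  shows "nilpotent_group H"
proof -
  obtain n where "lower_central G n = {\<one>}"
    using assms by (auto simp: nilpotent_group_def)
  then have "lower_central H n = {\<one>\<^bsub>H\<^esub>}" using lower_central_image[OF surj] by simp
  then show ?thesis using H.is_group by (auto simp: nilpotent_group_def)
qed

section \<open>Counting arguments in finite groups\<close>

context group
begin

text \<open>Jordan's counting argument: there is at most one conjugate of \<open>K\<close> for each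
  right coset, and each contributes at most \<open>card K - 1\<close> nonidentity elements. With
  index at least 2 this falls short of the group order.\<close>

lemma union_conjugates_neq_carrier:
  assumes fin: "finite (carrier G)" and K: "subgroup K G" "K \<noteq> carrier G"
  shows "(\<Union>x\<in>carrier G. inv x <# K #> x) \<noteq> carrier G"
proof
  assume cov: "(\<Union>x\<in>carrier G. inv x <# K #> x) = carrier G"
  have sub: "K \<subseteq> carrier G" using K(1) by (rule subgroup.subset)
  have finK: "finite K" using fin sub by (rule rev_finite_subset)
  have "\<forall>C\<in>rcosets K. \<exists>x. x \<in> carrier G \<and> C = K #> x"
    by (auto simp: RCOSETS_def)
  then obtain rep where rep: "\<And>C. C \<in> rcosets K \<Longrightarrow> rep C \<in> carrier G \<and> C = K #> rep C"
    by metis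
  let ?f = "\<lambda>(C, k). inv (rep C) \<otimes> k \<otimes> rep C"
  \<comment> \<open>The identity lies in every conjugate, so it is left out of the pairs and counted
    once through \<open>insert\<close>.\<close>
  let ?D = "(rcosets K) \<times> (K - {\<one>})"
  have "carrier G \<subseteq> insert \<one> (?f ` ?D)"
  proof
    fix g assume "g \<in> carrier G"
    then have "g \<in> (\<Union>x\<in>carrier G. inv x <# K #> x)" unfolding cov .
    then obtain x k where x: "x \<in> carrier G" "k \<in> K" "g = inv x \<otimes> k \<otimes> x"
      by (auto simp: l_coset_def r_coset_def)
    have C: "K #> x \<in> rcosets K" using x by (auto simp: RCOSETS_def)
    define y where "y = rep (K #> x)"
    have y: "y \<in> carrier G" "K #> x = K #> y" using rep[OF C] by (auto simp: y_def)
    have "x \<in> K #> y" using rcos_self[OF x(1) K(1)] y by simp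
    then obtain l where l: "l \<in> K" "x = l \<otimes> y" by (auto simp: r_coset_def)
    have c: "l \<in> carrier G" "k \<in> carrier G" using l x sub by auto
    have "g = inv y \<otimes> (inv l \<otimes> k \<otimes> l) \<otimes> y"
      using x l y c by (simp add: inv_mult_group m_assoc)
    moreover have m: "inv l \<otimes> k \<otimes> l \<in> K"
      using K(1) l x by (simp add: subgroup.m_closed subgroup.m_inv_closed)
    moreover have "g = \<one>" if "inv l \<otimes> k \<otimes> l = \<one>"
      using calculation(1) that y by simp
    ultimately show "g \<in> insert \<one> (?f ` ?D)"
      using C by (force simp: y_def image_iff)
  qed
  moreover have finD: "finite ?D"
    using finK fin by (simp add: RCOSETS_def)
  ultimately have "Coset.order G \<le> card (insert \<one> (?f ` ?D))"
    unfolding Coset.order_def by (intro card_mono) auto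
  also have "\<dots> \<le> Suc (card (?f ` ?D))" by (rule card_insert_le_m1) auto
  also have "\<dots> \<le> Suc (card ?D)" using card_image_le[OF finD] by simp
  also have "card ?D = card (rcosets K) * (card K - 1)"
    using finK subgroup.one_closed[OF K(1)] by (simp add: card_cartesian_product)
  finally have le: "Coset.order G \<le> Suc (card (rcosets K) * (card K - 1))" .
  have lag: "card (rcosets K) * card K = Coset.order G" by (rule lagrange[OF K(1)])
  have "card K < Coset.order G"
    unfolding Coset.order_def using fin sub K(2) by (intro psubset_card_mono) auto
  have K0: "card K > 0" using finK subgroup.one_closed[OF K(1)] by (auto simp: card_gt_0_iff)
  with \<open>card K < Coset.order G\<close> have "card (rcosets K) \<noteq> 0" "card (rcosets K) \<noteq> 1"
    using lag by (metis mult_0 not_less0, auto)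
  then have "card (rcosets K) \<ge> 2" by linarith
  moreover have "card (rcosets K) * card K = card (rcosets K) * (card K - 1) + card (rcosets K)"
    using K0 by (cases "card K") auto
  ultimately show False using le lag by linarith
qed

end

lemma (in group) finite_closed_subset_subgroup:
  assumes fin: "finite (carrier G)" and S: "S \<subseteq> carrier G" "S \<noteq> {}"
    and closed: "\<And>x y. x \<in> S \<Longrightarrow> y \<in> S \<Longrightarrow> x \<otimes> y \<in> S"
  shows "subgroup S G"
proof (rule subgroupI)
  have pow: "x [^] Suc k \<in> S" if "x \<in> S" for x and k
    using that closed S by (induction k) auto
  show "inv x \<in> S" if x: "x \<in> S" for x
  proof -
    have xc: "x \<in> carrier G" using x S by blast
    have o: "Coset.order G > 0" using fin order_gt_0_iff_finite by simp
    \<comment> \<open>The order is doubled so that the exponent \<open>Suc m\<close> of the inverse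
      is positive even in the trivial group.\<close>
    obtain m where m: "2 * Coset.order G = Suc (Suc m)" using o by (cases "Coset.order G") auto
    have "x [^] Suc m \<otimes> x = x [^] (Coset.order G * 2)" using m by (simp add: mult.commute)
    also have "\<dots> = \<one>" using xc by (simp add: pow_order_eq_1 flip: nat_pow_pow)
    finally have "inv x = x [^] Suc m" using xc by (metis inv_equality nat_pow_closed)
    then show ?thesis using pow[OF x] by simp
  qed
qed (use S closed in auto)

lemma (in group) card_subgroup_dvd:
  assumes "subgroup N G" "subgroup M G" "N \<subseteq> M"
  shows "card N dvd card M"
proof -
  interpret M: group "G\<lparr>carrier := M\<rparr>" using assms(2) by (rule subgroup_imp_group)
  have "card (rcosets\<^bsub>G\<lparr>carrier := M\<rparr>\<^esub> N) * card N = card M"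
    using M.lagrange[OF subgroup_incl[OF assms]] by (simp add: Coset.order_def)
  then show ?thesis by (metis dvd_triv_right)
qed

section \<open>Geometric sums modulo prime powers\<close>

text \<open>\<open>z ^ r - 1\<close> is \<open>z - 1\<close> times a sum of \<open>r\<close> powers
  of \<open>z\<close>, each congruent to 1 modulo \<open>r\<close>. Hence every further
  \<open>r\<close>-th power gains a factor \<open>r\<close>.\<close>

lemma power_prime_power_cong_1:
  fixes r y :: nat
  assumes "Factorial_Ring.prime r" "[y = 1] (mod r)"
  shows "[y ^ (r ^ e) = 1] (mod r ^ Suc e)"
proof (induction e)
  case 0
  then show ?case using assms by simp
next
  case (Suc e)
  define z where "z = y ^ (r ^ e)"
  have z: "[int z = 1] (mod int r ^ Suc e)"
    using Suc unfolding z_def by (metis cong_int_iff of_nat_1 of_nat_power)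
  then obtain t where t: "int z = 1 + int r ^ Suc e * t"
    by (metis cong_iff_lin cong_sym)
  have "[int z = 1] (mod int r)"
    using z by (rule cong_dvd_modulus) simp
  then have "[(\<Sum>i<r. int z ^ i) = (\<Sum>i<r. 1 ^ i)] (mod int r)"
    by (intro cong_sum cong_pow)
  then have "int r dvd (\<Sum>i<r. int z ^ i)" by (simp add: cong_0_iff[symmetric] cong_def)
  moreover have "int r ^ Suc e dvd int z - 1" using t by simp
  ultimately have "int r ^ Suc (Suc e) dvd (int z - 1) * (\<Sum>i<r. int z ^ i)"
    by (metis mult_dvd_mono power_Suc2)
  then have "int r ^ Suc (Suc e) dvd int z ^ r - 1"
    by (simp add: power_diff_1_eq)
  then have "[int z ^ r = 1] (mod int r ^ Suc (Suc e))"
    by (simp add: cong_iff_dvd_diff)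
  moreover have "int z ^ r = int (y ^ (r ^ Suc e))"
    by (simp add: z_def power_mult[symmetric] mult.commute)
  ultimately show ?case by (metis cong_int_iff of_nat_1 of_nat_power)
qed

text \<open>Writing \<open>z = 1 + r * t\<close> and expanding to first order, the sum is
  \<open>r\<close> plus \<open>r * t\<close> times the sum of the integers below \<open>r\<close>.
  For odd \<open>r\<close> the latter is itself divisible by \<open>r\<close>, so the sum is
  congruent to \<open>r\<close> modulo \<open>r ^ 2\<close>.\<close>

lemma prime_sq_not_dvd_geometric_sum:
  fixes r z :: nat
  assumes r: "Factorial_Ring.prime r" "r > 2" and z: "[z = 1] (mod r)"
  shows "\<not> r ^ 2 dvd (\<Sum>i<r. z ^ i)"
proof
  assume d: "r ^ 2 dvd (\<Sum>i<r. z ^ i)"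
  have "[int z = 1] (mod int r)" using z by (metis cong_int_iff of_nat_1)
  then obtain t where t: "int z = 1 + int r * t" by (metis cong_iff_lin cong_sym)
  have pow: "[int z ^ i = 1 + int i * (int r * t)] (mod int r ^ 2)" for i
  proof (induction i)
    case (Suc i)
    have "[int z ^ Suc i = (1 + int r * t) * (1 + int i * (int r * t))] (mod int r ^ 2)"
      unfolding power_Suc t[symmetric] using Suc by (rule cong_scalar_left)
    also have "(1 + int r * t) * (1 + int i * (int r * t)) =
        1 + int (Suc i) * (int r * t) + int r ^ 2 * (int i * t ^ 2)"
      by (simp add: algebra_simps power2_eq_square)
    also have "[\<dots> = 1 + int (Suc i) * (int r * t)] (mod int r ^ 2)"
      by (simp add: cong_def)
    finally show ?case .
  qed simp
  have "[(\<Sum>i<r. int z ^ i) = (\<Sum>i<r. 1 + int i * (int r * t))] (mod int r ^ 2)"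
    by (intro cong_sum pow)
  also have "(\<Sum>i<r. 1 + int i * (int r * t)) = int r + (\<Sum>i<r. int i) * (int r * t)"
    by (simp add: sum.distrib sum_distrib_right)
  finally have c: "[(\<Sum>i<r. int z ^ i) = int r + (\<Sum>i<r. int i) * (int r * t)] (mod int r ^ 2)" .
  have "odd r" using r by (simp add: prime_odd_nat)
  then obtain h where h: "r = 2 * h + 1" by (metis oddE)
  have "(\<Sum>i<n. int i) * 2 = int n * (int n - 1)" for n by (induction n) (auto simp: algebra_simps)
  from this[of r] have "(\<Sum>i<r. int i) = int r * int h"
    unfolding h by (simp add: algebra_simps)
  then have "[(\<Sum>i<r. int z ^ i) = int r + int r ^ 2 * (int h * t)] (mod int r ^ 2)"
    using c by (simp add: algebra_simps power2_eq_square)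
  moreover have "[(\<Sum>i<r. int z ^ i) = 0] (mod int r ^ 2)"
  proof -
    have "int (r ^ 2) dvd int (\<Sum>i<r. z ^ i)" using d by (simp only: int_dvd_int_iff)
    then show ?thesis by (simp add: cong_0_iff)
  qed
  ultimately have "[int r + int r ^ 2 * (int h * t) = 0] (mod int r ^ 2)"
    by (metis cong_sym cong_trans)
  then have "int r ^ 2 dvd int r" by (simp add: cong_0_iff dvd_add_left_iff)
  then have "r ^ 2 dvd r" by (metis int_dvd_int_iff of_nat_power)
  then show False using r by (auto dest!: dvd_imp_le simp: power2_eq_square)
qed

text \<open>The exponents below \<open>m * n\<close> are grouped into \<open>n\<close> blocks of
  length \<open>m\<close>.\<close>

lemma geometric_sum_mult:
  "(\<Sum>i<(m::nat) * n. (z::'a::comm_semiring_1) ^ i) = (\<Sum>i<n. (z ^ m) ^ i) * (\<Sum>i<m. z ^ i)"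
proof (induction n)
  case (Suc n)
  have "(\<Sum>i<m * Suc n. z ^ i) = (\<Sum>i<m * n + m. z ^ i)" by (simp add: algebra_simps)
  also have "\<dots> = (\<Sum>i<m * n. z ^ i) + (\<Sum>i=m * n..<m * n + m. z ^ i)"
    by (simp add: lessThan_atLeast0 sum.atLeastLessThan_concat)
  also have "(\<Sum>i=m * n..<m * n + m. z ^ i) = (\<Sum>i<m. z ^ (m * n + i))"
    using sum.shift_bounds_nat_ivl[of "\<lambda>i. z ^ i" 0 "m * n" m]
    by (simp add: lessThan_atLeast0 add.commute)
  also have "\<dots> = (z ^ m) ^ n * (\<Sum>i<m. z ^ i)"
    by (simp add: power_add power_mult sum_distrib_left)
  finally show ?case by (simp add: Suc algebra_simps)
qed simp

text \<open>The sum of length \<open>r ^ Suc k\<close> factors into a sum of \<open>r\<close> powers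
  of \<open>z ^ (r ^ k)\<close>, which has at most one factor \<open>r\<close>, and the sum of
  length \<open>r ^ k\<close>; multiplicities add. This bounds the \<open>r\<close>-part of the norm
  exponent.\<close>

lemma prime_power_not_dvd_geometric_sum:
  fixes r z :: nat
  assumes r: "Factorial_Ring.prime r" "r > 2" and z: "[z = 1] (mod r)"
  shows "\<not> r ^ Suc k dvd (\<Sum>i<r ^ k. z ^ i)"
proof (induction k)
  case 0
  then show ?case using r by (simp add: prime_gt_1_nat)
next
  case (Suc k)
  define A where "A = (\<Sum>i<r. (z ^ (r ^ k)) ^ i)"
  define B where "B = (\<Sum>i<r ^ k. z ^ i)"
  have AB: "(\<Sum>i<r ^ Suc k. z ^ i) = A * B"
    unfolding A_def B_def by (subst geometric_sum_mult[symmetric]) (simp add: mult.commute)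
  have "[z ^ (r ^ k) = 1] (mod r)" using cong_pow[OF z, of "r ^ k"] by simp
  then have A2: "\<not> r ^ 2 dvd A" unfolding A_def using r by (intro prime_sq_not_dvd_geometric_sum)
  have B2: "\<not> r ^ Suc k dvd B" unfolding B_def by (rule Suc.IH)
  have A0: "A \<noteq> 0" "B \<noteq> 0" using A2 B2 by (metis dvd_0_right)+
  have "multiplicity r A < 2"
    using A2 A0 r by (metis multiplicity_dvd' not_le)
  moreover have "multiplicity r B < Suc k"
    using B2 by (metis multiplicity_dvd' not_le)
  moreover have "multiplicity r (A * B) = multiplicity r A + multiplicity r B"
    using A0 r by (intro prime_elem_multiplicity_mult_distrib) auto
  ultimately have "multiplicity r (A * B) < Suc (Suc k)" by simp
  then show ?case
    unfolding AB using A0 r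
    by (metis multiplicity_geI mult_eq_0_iff not_le not_prime_unit prime_imp_prime_elem power_dvd_iff_le_multiplicity)
qed

section \<open>Semilinear maps of a finite field\<close>

text \<open>The type-class field is repackaged as a ring record so that the cyclicity of its
  multiplicative group can be taken from the algebra library.\<close>

lemma finite_field_generator:
  obtains g :: "'a::finite_field" where "g \<noteq> 0" "\<And>x. x \<noteq> 0 \<Longrightarrow> \<exists>k::nat. x = g ^ k"
proof -
  define R :: "'a ring" where "R = \<lparr>carrier = UNIV, monoid.mult = (*), one = 1, ring.zero = 0, ring.add = (+)\<rparr>"
  have sel: "carrier R = UNIV" "monoid.mult R = (*)" "monoid.one R = 1" "ring.zero R = 0" "ring.add R = (+)"
    by (simp_all add: R_def)
  have "abelian_group R"
  proof (rule abelian_groupI)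
    show "\<exists>y\<in>carrier R. y \<oplus>\<^bsub>R\<^esub> x = \<zero>\<^bsub>R\<^esub>" for x
      unfolding sel by (rule bexI[of _ "- x"]) auto
  qed (auto simp: sel algebra_simps)
  moreover have "comm_monoid R"
    by (rule comm_monoidI) (auto simp: sel algebra_simps)
  ultimately have "cring R"
    by (rule cringI) (auto simp: sel algebra_simps)
  moreover have "Units R = carrier R - {\<zero>\<^bsub>R\<^esub>}"
  proof -
    have "x \<in> Units R" if "x \<noteq> 0" for x
      unfolding Units_def sel using that by (auto intro!: exI[of _ "inverse x"])
    moreover have "0 \<notin> Units R" by (auto simp: Units_def sel)
    ultimately show ?thesis by (auto simp: sel)
  qed
  ultimately have "field R" by (rule cring.cring_fieldI)
  then obtain g where g: "g \<in> carrier (mult_of R)"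
    "carrier (mult_of R) = {g [^]\<^bsub>R\<^esub> i | i::nat. i \<in> UNIV}"
    using field.finite_field_mult_group_has_gen[of R] by (auto simp: sel)
  have pow: "x [^]\<^bsub>R\<^esub> i = x ^ i" for x and i :: nat
    by (induction i) (auto simp: sel nat_pow_def algebra_simps)
  have "carrier (mult_of R) = UNIV - {0}" by (simp add: sel)
  with g have "g \<noteq> 0" "UNIV - {0} = {g ^ i | i::nat. i \<in> UNIV}" by (simp_all add: pow sel)
  then show thesis by (intro that[of g]) blast+
qed

lemma finite_field_poly_eq_0:
  fixes P :: "'a::finite_field poly"
  assumes "\<And>x. poly P x = 0" "Polynomial.degree P < card (UNIV :: 'a set)"
  shows "P = 0"
proof (rule ccontr)
  assume "P \<noteq> 0"
  then have "card {x. poly P x = 0} \<le> Polynomial.degree P" by (rule card_poly_roots_bound)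
  with assms show False by simp
qed

lemma card_finite_field_ge_2: "card (UNIV :: 'a::finite_field set) \<ge> 2"
  using card_mono[of UNIV "{0, 1 :: 'a}"] by simp

lemma finite_field_power_minus_one:
  fixes x :: "'a::finite_field"
  assumes "x \<noteq> 0"
  shows "x ^ (card (UNIV :: 'a set) - 1) = 1"
proof -
  have "x * x ^ (card (UNIV :: 'a set) - 1) = x * 1"
    using finite_field_power_card_eq_same[of x] card_finite_field_ge_2[where 'a = 'a]
    by (simp flip: power_Suc)
  with assms show ?thesis by (simp only: mult_cancel_left) simp
qed

lemma field_automorphism_0:
  assumes "field_automorphism \<sigma>" shows "\<sigma> 0 = 0"
  using assms unfolding field_automorphism_def by (metis add_cancel_left_right)

lemma field_automorphism_power:
  assumes "field_automorphism \<sigma>" shows "\<sigma> (x ^ k) = \<sigma> x ^ k"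
  using assms by (induction k) (auto simp: field_automorphism_def)

lemma power_gcd_eq_1:
  fixes c :: "'a::comm_semiring_1"
  assumes "c ^ a = 1" "c ^ b = 1"
  shows "c ^ gcd a b = 1"
proof (cases "a = 0")
  case False
  then obtain x y where xy: "a * x = b * y + gcd a b" using bezout_nat by metis
  have "1 = c ^ (a * x)" using assms(1) by (simp add: power_mult)
  also have "\<dots> = c ^ gcd a b" unfolding xy power_add by (simp add: power_mult assms(2))
  finally show ?thesis ..
qed (use assms in simp)

lemma Fermat_prime_power_cong:
  fixes y r k :: nat
  assumes "Factorial_Ring.prime r"
  shows "[y ^ (r ^ k) = y] (mod r)"
proof (induction k)
  case (Suc k)
  have F: "[z ^ r = z] (mod r)" for z :: nat
  proof (cases "r dvd z")
    case True
    moreover have "r > 0" using assms by (rule prime_gt_0_nat)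
    ultimately have "r dvd z ^ r" by (metis dvd_power dvd_trans dvd_power_same)
    then show ?thesis using True by (simp add: cong_def mod_eq_0_iff_dvd)
  next
    case False
    have "[z * z ^ (r - 1) = z * 1] (mod r)"
      using fermat_theorem[OF assms False] by (rule cong_scalar_left)
    then show ?thesis using prime_gt_0_nat[OF assms] by (metis Suc_diff_1 mult_1_right power_Suc)
  qed
  have "y ^ (r ^ Suc k) = (y ^ (r ^ k)) ^ r" by (simp add: mult.commute flip: power_mult)
  with F[of "y ^ (r ^ k)"] Suc show ?case by (metis cong_trans)
qed simp

text \<open>Iterating \<open>c * u ^ y = u\<close> for \<open>r ^ k\<close> rounds gives
  \<open>c ^ M * u = u\<close>, where \<open>M\<close> is the geometric sum of length
  \<open>r ^ k\<close>. So \<open>c ^ M = 1\<close>; since \<open>c\<close> has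
  \<open>r\<close>-power order and \<open>M\<close> has at most \<open>k\<close> factors
  \<open>r\<close>, the power \<open>c ^ (r ^ k)\<close> is 1 too.\<close>

lemma norm_one_power:
  fixes c u :: "'a::field" and r y k e :: nat
  assumes r: "Factorial_Ring.prime r" "r > 2" and y: "[y = 1] (mod r)"
    and u: "u \<noteq> 0" "c * u ^ y = u" "u ^ (y ^ (r ^ k)) = u" and c: "c ^ (r ^ e) = 1"
  shows "c ^ (r ^ k) = 1"
proof -
  have iter: "c ^ (\<Sum>i<l. y ^ i) * u ^ (y ^ l) = u" for l
  proof (induction l)
    case (Suc l)
    have "c ^ (\<Sum>i<Suc l. y ^ i) * u ^ (y ^ Suc l) = c ^ (\<Sum>i<l. y ^ i) * (c * u ^ y) ^ (y ^ l)"
      by (simp add: power_add power_mult_distrib flip: power_mult)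
    then show ?case using Suc u(2) by simp
  qed simp
  let ?M = "\<Sum>i<r ^ k. y ^ i"
  have "c ^ ?M * u = 1 * u" using iter[of "r ^ k"] u(3) by simp
  then have "c ^ ?M = 1" using u(1) by (simp only: mult_cancel_right) simp
  then have g: "c ^ gcd ?M (r ^ e) = 1" using c by (intro power_gcd_eq_1)
  have "gcd ?M (r ^ e) dvd r ^ e" by simp
  then obtain l where l: "l \<le> e" "gcd ?M (r ^ e) = r ^ l"
    using divides_primepow_nat[OF r(1)] by blast
  have "r ^ l dvd ?M" using l(2) by (metis gcd_dvd1)
  have "l \<le> k"
  proof (rule ccontr)
    assume "\<not> l \<le> k"
    then have "r ^ Suc k dvd r ^ l" by (intro le_imp_power_dvd) simp
    with \<open>r ^ l dvd ?M\<close> have "r ^ Suc k dvd ?M" by (metis dvd_trans)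
    with prime_power_not_dvd_geometric_sum[OF r y, of k] show False by simp
  qed
  then have "r ^ k = r ^ l * r ^ (k - l)" by (simp flip: power_add)
  then show ?thesis using g l(2) by (simp add: power_mult)
qed

text \<open>The general shape of a semilinear map in characteristic \<open>p\<close>. It is a
  relation and not a function of \<open>h\<close>, since over a field with \<open>p ^ n\<close>
  elements \<open>i\<close> is determined only modulo \<open>n\<close>.\<close>

definition frob_exponent :: "nat \<Rightarrow> nat \<Rightarrow> ('a::field \<Rightarrow> 'a) \<Rightarrow> bool" where
  "frob_exponent p i h \<longleftrightarrow> (\<exists>a. a \<noteq> 0 \<and> h = (\<lambda>x. a * x ^ (p ^ i)))"

lemma frob_exponent_id: "frob_exponent p 0 id"
  unfolding frob_exponent_def by (intro exI[of _ 1]) auto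

lemma frob_exponent_comp:
  assumes "frob_exponent p i g" "frob_exponent p j h" shows "frob_exponent p (i + j) (g \<circ> h)"
proof -
  obtain a b where "a \<noteq> 0" "g = (\<lambda>x. a * x ^ (p ^ i))" "b \<noteq> 0" "h = (\<lambda>x. b * x ^ (p ^ j))"
    using assms by (auto simp: frob_exponent_def)
  then show ?thesis unfolding frob_exponent_def
    by (intro exI[of _ "a * b ^ (p ^ i)"])
       (auto simp: power_mult_distrib power_add mult.commute simp flip: power_mult)
qed

lemma frob_exponent_funpow:
  assumes "frob_exponent p i h" shows "frob_exponent p (t * i) (h ^^ t)"
  using assms by (induction t) (auto simp: frob_exponent_id frob_exponent_comp)

section \<open>The Frobenius map of a field with \<open>p ^ n\<close> elements\<close>

context
  fixes p n :: nat
  assumes p: "Factorial_Ring.prime p" and card: "card (UNIV :: 'a::finite_field set) = p ^ n"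
begin

lemma card_exponent_pos: "n > 0"
  using card card_finite_field_ge_2[where 'a = 'a] by (cases n) auto

lemma CHAR_finite_field: "CHAR('a) = p"
proof -
  have "CHAR('a) dvd p ^ n"
    using card by (metis CHAR_dvd_CARD)
  then have "CHAR('a) dvd p"
    using CHAR_prime prime_dvd_power by blast
  then show ?thesis using p CHAR_prime by (metis primes_dvd_imp_eq)
qed

lemma Frobenius_add: "((x::'a) + y) ^ (p ^ i) = x ^ (p ^ i) + y ^ (p ^ i)"
  using freshmans_dream'[where 'a = 'a, OF CHAR_prime, of "p ^ i" i x y]
  by (simp add: CHAR_finite_field)

lemma power_card_mult: "(x::'a) ^ (p ^ (n * u)) = x"
  using finite_field_power_card_power_eq_same[of "p ^ (n * u)" u x] card
  by (simp add: power_mult)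

lemma Frobenius_mod: "(x::'a) ^ (p ^ i) = x ^ (p ^ (i mod n))"
proof -
  have "x ^ (p ^ i) = (x ^ (p ^ (n * (i div n)))) ^ (p ^ (i mod n))"
    by (simp flip: power_mult[of x] power_add)
  then show ?thesis by (simp only: power_card_mult)
qed

text \<open>Otherwise, with \<open>v = i mod n\<close> positive, the nonzero polynomial
  \<open>X ^ (p ^ v) - X\<close> vanishes on the whole field although its degree is less than
  \<open>p ^ n\<close>.\<close>

lemma Frobenius_eq_id_imp_dvd:
  assumes "\<And>x::'a. x ^ (p ^ i) = x"
  shows "n dvd i"
proof (rule ccontr)
  assume "\<not> n dvd i"
  then have v: "i mod n > 0" by (simp add: mod_greater_zero_iff_not_dvd)
  let ?v = "i mod n"
  let ?P = "Polynomial.monom 1 (p ^ ?v) - Polynomial.monom 1 1 :: 'a poly"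
  have p1: "p > 1" using p by (rule prime_gt_1_nat)
  have d: "1 < p ^ ?v" using p1 v by (rule one_less_power)
  have "?v < n" using card_exponent_pos by simp
  then have "p ^ ?v < p ^ n" using p1 by (rule power_strict_increasing)
  moreover have "Polynomial.degree ?P \<le> p ^ ?v"
    using d by (intro degree_diff_le) (auto simp: degree_monom_eq)
  ultimately have "?P = 0"
    using assms card by (intro finite_field_poly_eq_0) (auto simp: poly_monom simp flip: Frobenius_mod)
  then have "coeff ?P (p ^ ?v) = 0" by simp
  then show False using d by simp
qed

lemma Frobenius_surj: "\<exists>x::'a. y = x ^ (p ^ i)"
proof -
  have "i \<le> n * i" using card_exponent_pos by simp
  then have "(y ^ (p ^ (n * i - i))) ^ (p ^ i) = y ^ (p ^ (n * i))"
    by (simp flip: power_mult power_add)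
  then show ?thesis by (metis power_card_mult)
qed

text \<open>An automorphism is a power map \<open>x \<mapsto> x ^ e\<close> with \<open>0 < e < p ^ n\<close>. If \<open>e = p ^ i * m\<close> with
  \<open>m\<close> prime to \<open>p\<close>, additivity gives the polynomial identity \<open>(X + 1) ^ m = X ^ m + 1\<close>, and
  comparing the derivatives at \<open>0\<close> gives \<open>m = 1\<close>.\<close>

lemma field_automorphism_Frobenius:
  assumes \<sigma>: "field_automorphism (\<sigma> :: 'a \<Rightarrow> 'a)"
  shows "\<exists>i. \<sigma> = (\<lambda>x. x ^ (p ^ i))"
proof -
  obtain g :: 'a where g: "g \<noteq> 0" "\<And>x. x \<noteq> 0 \<Longrightarrow> \<exists>k::nat. x = g ^ k"
    by (rule finite_field_generator) blast
  let ?q = "card (UNIV :: 'a set)"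
  have inj: "inj \<sigma>" using \<sigma> by (simp add: field_automorphism_def bij_is_inj)
  have "\<sigma> g \<noteq> 0" using g(1) field_automorphism_0[OF \<sigma>] inj by (metis injD)
  then obtain e0 where "\<sigma> g = g ^ e0" using g by blast
  then have "\<sigma> g = g ^ (e0 + (?q - 1))"
    unfolding power_add finite_field_power_minus_one[OF g(1)] by simp
  moreover have "e0 + (?q - 1) > 0" using card_finite_field_ge_2[where 'a = 'a] by simp
  ultimately have ex: "\<exists>e. e > 0 \<and> \<sigma> g = g ^ e" by blast
  \<comment> \<open>Exponents of \<open>g\<close> matter only modulo \<open>?q - 1\<close>, so the
    least positive one is smaller than \<open>?q\<close>. This bounds the degree of the polynomial
    considered below.\<close>
  define e where "e = (LEAST e. e > 0 \<and> \<sigma> g = g ^ e)"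
  have e: "e > 0" "\<sigma> g = g ^ e" using LeastI_ex[OF ex] by (simp_all add: e_def)
  have least: "e \<le> k" if "k > 0" "\<sigma> g = g ^ k" for k
    unfolding e_def using that by (intro Least_le conjI)
  have eq: "e < ?q"
  proof (rule ccontr)
    assume "\<not> e < ?q"
    then have e': "e - (?q - 1) > 0" "e - (?q - 1) < e"
      and split: "(e - (?q - 1)) + (?q - 1) = e"
      using card_finite_field_ge_2[where 'a = 'a] by auto
    have "\<sigma> g = g ^ ((e - (?q - 1)) + (?q - 1))" unfolding split by (rule e(2))
    then have "\<sigma> g = g ^ (e - (?q - 1))"
      unfolding power_add finite_field_power_minus_one[OF g(1)] by simp
    from least[OF e'(1) this] e'(2) show False by linarith
  qed
  have \<sigma>e: "\<sigma> x = x ^ e" for x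
  proof (cases "x = 0")
    case True
    then show ?thesis using e(1) field_automorphism_0[OF \<sigma>] by simp
  next
    case False
    then obtain k where "x = g ^ k" using g by blast
    then show ?thesis by (simp add: field_automorphism_power[OF \<sigma>] e(2) mult.commute flip: power_mult)
  qed
  obtain m where m: "e = p ^ multiplicity p e * m" "\<not> p dvd m"
    using multiplicity_decompose'[of e p] e(1) p by (metis not_prime_unit not_gr_zero)
  define i where "i = multiplicity p e"
  have ei: "e = p ^ i * m" unfolding i_def by (rule m(1))
  have mp: "((y::'a) + 1) ^ m = y ^ m + 1" for y
  proof -
    obtain x where x: "y = x ^ (p ^ i)" using Frobenius_surj[of y i] by blast
    have "(y + 1) ^ m = (x + 1) ^ e"
      unfolding ei power_mult by (simp add: Frobenius_add x)
    also have "\<dots> = x ^ e + 1"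
      using \<sigma> unfolding \<sigma>e[symmetric] by (simp add: field_automorphism_def)
    also have "x ^ e = y ^ m" unfolding ei power_mult x ..
    finally show ?thesis .
  qed
  have m0: "m > 0" using m e(1) by (cases m) auto
  have "m = 1"
  proof (rule ccontr)
    assume "m \<noteq> 1"
    then have m1: "m > 1" using m0 by simp
    let ?P = "[:1, 1:] ^ m - Polynomial.monom 1 m - 1 :: 'a poly"
    have "m \<le> e" using m p by (metis dvd_imp_le dvd_triv_right e(1))
    moreover have "Polynomial.degree ([:1, 1:] ^ m :: 'a poly) \<le> m"
      by (rule order_trans[OF degree_power_le]) simp
    then have "Polynomial.degree ?P \<le> m"
      by (intro degree_diff_le) (auto simp: degree_monom_eq)
    ultimately have "?P = 0"
      using mp eq by (intro finite_field_poly_eq_0) (auto simp: poly_monom poly_power add.commute)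
    then have "poly (pderiv ?P) 0 = 0" by simp
    then have "of_nat m = (0::'a)"
      using m1 by (simp add: pderiv_diff pderiv_power pderiv_monom poly_monom pderiv_pCons power_0_left)
    then have "p dvd m" by (simp add: of_nat_eq_0_iff_char_dvd CHAR_finite_field)
    with m(2) show False ..
  qed
  then have "\<sigma> = (\<lambda>x. x ^ (p ^ i))" using \<sigma>e ei by auto
  then show ?thesis ..
qed

lemma GammaL1_Frobenius:
  assumes "h \<in> (GammaL1 :: ('a \<Rightarrow> 'a) set)"
  shows "\<exists>a i. a \<noteq> 0 \<and> h = (\<lambda>x. a * x ^ (p ^ i))"
  using assms field_automorphism_Frobenius by (fastforce simp: GammaL1_def)

section \<open>Frobenius exponents of semilinear maps\<close>

lemma frob_exponent_cong:
  fixes h :: "'a \<Rightarrow> 'a"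
  assumes "frob_exponent p i h" "i mod n = j mod n" shows "frob_exponent p j h"
proof -
  have "x ^ (p ^ i) = x ^ (p ^ j)" for x :: 'a
    using Frobenius_mod[of x i] Frobenius_mod[of x j] assms(2) by simp
  with assms(1) show ?thesis by (simp add: frob_exponent_def)
qed

text \<open>Evaluation at 1 identifies the coefficients. Composition with the inverse of the
  \<open>j\<close>-th Frobenius power, which is the power with exponent \<open>n * j - j\<close>,
  then reduces to \<open>Frobenius_eq_id_imp_dvd\<close>.\<close>

lemma frob_exponent_unique:
  fixes h :: "'a \<Rightarrow> 'a"
  assumes "frob_exponent p i h" "frob_exponent p j h" shows "i mod n = j mod n"
proof -
  obtain a where a: "a \<noteq> 0" "h = (\<lambda>x. a * x ^ (p ^ i))"
    using assms(1) by (auto simp: frob_exponent_def)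
  obtain b where b: "h = (\<lambda>x. b * x ^ (p ^ j))"
    using assms(2) by (auto simp: frob_exponent_def)
  have eq: "a * x ^ (p ^ i) = b * x ^ (p ^ j)" for x using fun_cong[OF a(2)[symmetric], of x] b by simp
  from eq[of 1] have "a = b" by simp
  then have eq': "x ^ (p ^ i) = x ^ (p ^ j)" for x :: 'a using eq[of x] a(1) by simp
  have le: "j \<le> n * j" using card_exponent_pos by simp
  have "x ^ (p ^ (n * j - j + i)) = x" for x :: 'a
  proof -
    have "x ^ (p ^ (n * j - j + i)) = (x ^ (p ^ (n * j - j))) ^ (p ^ i)"
      by (simp add: power_add power_mult)
    also have "\<dots> = (x ^ (p ^ (n * j - j))) ^ (p ^ j)" by (rule eq')
    also have "\<dots> = x ^ (p ^ (n * j))"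
      using le by (simp flip: power_mult power_add)
    finally show ?thesis by (simp only: power_card_mult)
  qed
  then have "n dvd n * j - j + i" by (rule Frobenius_eq_id_imp_dvd)
  then have "(n * j - j + i + j) mod n = j mod n" by (metis add.commute add.right_neutral dvd_imp_mod_0 mod_add_right_eq)
  moreover have "n * j - j + i + j = i + n * j" using le by linarith
  ultimately show ?thesis by simp
qed

text \<open>The exponents occurring in \<open>R\<close> are closed under addition and under
  congruence modulo \<open>n\<close>, so they form the preimage of a subgroup of the cyclic group of
  order \<open>n\<close>; \<open>d\<close> is its least positive representative.\<close>

lemma frob_exponents_multiples:
  fixes R :: "('a \<Rightarrow> 'a) set"
  assumes id: "id \<in> R" and comp: "\<And>g h. g \<in> R \<Longrightarrow> h \<in> R \<Longrightarrow> g \<circ> h \<in> R"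
  obtains d where "d > 0" "d dvd n" "\<exists>h\<in>R. frob_exponent p d h"
    "\<And>h i. h \<in> R \<Longrightarrow> frob_exponent p i h \<Longrightarrow> d dvd i"
proof -
  define I where "I = {i. \<exists>h\<in>R. frob_exponent p i h}"
  have n: "n > 0" by (rule card_exponent_pos)
  have mem0: "0 \<in> I" using id frob_exponent_id unfolding I_def by blast
  have add: "i + j \<in> I" if "i \<in> I" "j \<in> I" for i j
    using that frob_exponent_comp comp unfolding I_def by blast
  have mult: "i * t \<in> I" if "i \<in> I" for i t
    using add[OF that] mem0 by (induction t) auto
  have cong: "j \<in> I" if "i \<in> I" "i mod n = j mod n" for i j
    using that frob_exponent_cong unfolding I_def by blast
  have memn: "n \<in> I" using mem0 by (rule cong) simp
  define d where "d = (LEAST d. d > 0 \<and> d \<in> I)"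
  have d: "d > 0 \<and> d \<in> I" unfolding d_def by (rule LeastI[of _ n]) (use n memn in simp)
  have least: "d \<le> i" if "i > 0" "i \<in> I" for i
    unfolding d_def using that by (intro Least_le conjI)
  have dvd: "d dvd i" if "i \<in> I" for i
  proof (rule ccontr)
    assume nd: "\<not> d dvd i"
    \<comment> \<open>Subtraction of \<open>i div d\<close> copies of \<open>d\<close> is replaced
      by addition of \<open>n - 1\<close> times as many, which is the same modulo
      \<open>n\<close>.\<close>
    have "i + d * ((i div d) * (n - 1)) \<in> I" using add mult that d by blast
    moreover have "i + d * ((i div d) * (n - 1)) = i mod d + n * (d * (i div d))"
    proof -
      have "d * (i div d) + d * ((i div d) * (n - 1)) = n * (d * (i div d))"
        using n by (cases n) auto
      then show ?thesis by (metis add.assoc add.commute mod_mult_div_eq)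
    qed
    ultimately have "i mod d + n * (d * (i div d)) \<in> I" by (simp only:)
    then have "i mod d \<in> I" by (rule cong) simp
    moreover have "i mod d > 0" using nd by (simp add: mod_greater_zero_iff_not_dvd)
    ultimately have "d \<le> i mod d" using least by blast
    moreover have "i mod d < d" using d by simp
    ultimately show False by simp
  qed
  show thesis
    by (rule that[of d]) (use d dvd memn in \<open>auto simp: I_def\<close>)
qed

text \<open>The core of the argument, to be applied to the Sylow \<open>r\<close>-subgroup. Three
  cases: no nontrivial automorphism is induced; no fixing element induces a generator; some fixing
  element does. The property \<open>central\<close> is assumed here because it comes from the
  irreducibility of the whole stabilizer.\<close>

lemma fixing_elements_in_proper_submonoid:
  fixes R :: "('a \<Rightarrow> 'a) set" and r e :: nat
  assumes r: "Factorial_Ring.prime r" "r > 2"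
    and id: "id \<in> R" and comp: "\<And>g h. g \<in> R \<Longrightarrow> h \<in> R \<Longrightarrow> g \<circ> h \<in> R"
    and semilinear: "\<And>h. h \<in> R \<Longrightarrow> \<exists>i. frob_exponent p i h"
    and order: "\<And>h. h \<in> R \<Longrightarrow> h ^^ (r ^ e) = id"
    and central: "\<And>z v. z \<in> R \<Longrightarrow> (\<And>h. h \<in> R \<Longrightarrow> z \<circ> h = h \<circ> z) \<Longrightarrow> v \<noteq> 0 \<Longrightarrow> z v = v \<Longrightarrow> z = id"
    and nontrivial: "R \<noteq> {id}"
  obtains B where "B \<subset> R" "id \<in> B" "\<And>g h. g \<in> B \<Longrightarrow> h \<in> B \<Longrightarrow> g \<circ> h \<in> B"
    "fixing_elements R \<subseteq> B"
proof -
  obtain d where d: "d > 0" "d dvd n" "\<exists>h\<in>R. frob_exponent p d h"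
    "\<And>h i. h \<in> R \<Longrightarrow> frob_exponent p i h \<Longrightarrow> d dvd i"
    by (rule frob_exponents_multiples[OF id comp]) blast+
  obtain h0 where h0: "h0 \<in> R" "frob_exponent p d h0" using d(3) by blast
  \<comment> \<open>\<open>N\<close> is the order of the cyclic group of automorphisms induced by
    \<open>R\<close>. It is a power of \<open>r\<close>, since \<open>h0\<close> induces a generator
    and has order dividing \<open>r ^ e\<close>.\<close>
  obtain N where N: "n = d * N" using d(2) by (rule dvdE)
  have "frob_exponent p (r ^ e * d) (id :: 'a \<Rightarrow> 'a)"
    using frob_exponent_funpow[OF h0(2), of "r ^ e"] order[OF h0(1)] by simp
  then have "(r ^ e * d) mod n = 0 mod n"
    using frob_exponent_unique frob_exponent_id by blast
  then have "d * N dvd d * r ^ e" unfolding N[symmetric] by (simp add: mod_eq_0_iff_dvd mult.commute)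
  then have "N dvd r ^ e" using d(1) by simp
  then obtain k where k: "N = r ^ k" using divides_primepow_nat[OF r(1)] by blast
  have nk: "n = d * r ^ k" using N k by simp
  have r1: "r > 1" using r by simp
  show thesis
  proof (cases "k = 0")
    case True
    \<comment> \<open>Here \<open>n = d\<close>, so all elements of \<open>R\<close> are
      multiplications by scalars, and such a map with a nonzero fixed vector is the
      identity.\<close>
    have "h = id" if h: "h \<in> fixing_elements R" for h
    proof -
      have hR: "h \<in> R" using h by (simp add: fixing_elements_def)
      obtain v where v: "v \<noteq> 0" "h v = v" using h by (auto simp: fixing_elements_def)
      obtain i where i: "frob_exponent p i h" using semilinear[OF hR] by blast
      have "i mod n = 0 mod n" using d(4)[OF hR i] nk True by simp
      then have "frob_exponent p 0 h" by (rule frob_exponent_cong[OF i])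
      then obtain a where a: "h = (\<lambda>x. a * x ^ (p ^ 0))" unfolding frob_exponent_def by blast
      with v have "a = 1" by simp
      with a show ?thesis by auto
    qed
    then show thesis using id nontrivial by (intro that[of "{id}"]) auto
  next
    case k0: False
    show thesis
    proof (cases "\<forall>h\<in>fixing_elements R. \<forall>i. frob_exponent p i h \<longrightarrow> d * r dvd i")
      case True
      \<comment> \<open>The preimage of the subgroup of index \<open>r\<close> in the group of
        induced automorphisms; \<open>h0\<close> lies outside it.\<close>
      let ?B = "{h \<in> R. \<exists>i. frob_exponent p i h \<and> d * r dvd i}"
      have "h0 \<notin> ?B"
      proof
        assume "h0 \<in> ?B"
        then obtain i where i: "frob_exponent p i h0" "d * r dvd i" by blast
        have "i mod n = d mod n" using frob_exponent_unique[OF i(1) h0(2)] .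
        moreover have "d * r dvd n" using nk k0 by (cases k) auto
        ultimately have "d * r dvd d" using i(2) by (metis dvd_mod_iff)
        then have "d * r dvd d * 1" by simp
        then show False using d(1) r1 by (simp only: nat_mult_dvd_cancel_disj) simp
      qed
      then have "?B \<subset> R" using h0 by blast
      moreover have "id \<in> ?B" using id frob_exponent_id by auto
      moreover have "g \<circ> h \<in> ?B" if "g \<in> ?B" "h \<in> ?B" for g h
        using that comp frob_exponent_comp by (blast intro: dvd_add)
      moreover have "fixing_elements R \<subseteq> ?B"
        using True semilinear by (fastforce simp: fixing_elements_def)
      ultimately show thesis by (rule that)
    next
      case False
      then obtain h1 i1 where h1: "h1 \<in> R" "frob_exponent p i1 h1" "\<not> d * r dvd i1"
        and fixh1: "\<exists>w. w \<noteq> 0 \<and> h1 w = w"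
        by (auto simp: fixing_elements_def)
      obtain w where w: "w \<noteq> 0" "h1 w = w" using fixh1 by blast
      obtain u where u: "i1 = d * u" using d(4)[OF h1(1,2)] by (rule dvdE)
      have "\<not> r dvd u" using h1(3) u by auto
      then have "coprime u (r ^ k)" using r(1) by (metis coprime_commute coprime_power_right_iff prime_imp_coprime)
      \<comment> \<open>Inverting \<open>u\<close> modulo \<open>r ^ k\<close> makes
        \<open>h1 ^^ t\<close>, which still fixes \<open>w\<close>, an element of exponent exactly
        \<open>d\<close>.\<close>
      then obtain t where t: "[u * t = 1] (mod r ^ k)" using cong_solve_coprime_nat[of u "r ^ k"] by auto
      define x where "x = h1 ^^ t"
      have powR: "h ^^ m \<in> R" if "h \<in> R" for h m
        using that id comp by (induction m) auto
      have xR: "x \<in> R" unfolding x_def using h1(1) by (rule powR)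
      have xw: "x w = w" unfolding x_def using w(2) by (induction t) auto
      have "frob_exponent p (t * i1) x" unfolding x_def by (rule frob_exponent_funpow[OF h1(2)])
      moreover have "(t * i1) mod n = d mod n"
      proof -
        have "[d * (u * t) = d * 1] (mod d * r ^ k)"
          using t by (simp only: cong_def mult_mod_right[symmetric])
        then show ?thesis by (simp add: cong_def u nk mult_ac)
      qed
      ultimately have "frob_exponent p d x" by (rule frob_exponent_cong)
      then obtain b where b: "b \<noteq> 0" "x = (\<lambda>v. b * v ^ (p ^ d))" by (auto simp: frob_exponent_def)
      have bw: "b * w ^ (p ^ d) = w" using xw b(2) by simp
      \<comment> \<open>\<open>S m c\<close> is multiplication by \<open>c\<close> after \<open>x ^^ m\<close>\<close>
      define S where "S m c = (\<lambda>v. c * w * (v / w) ^ (p ^ (d * m)))" for m and c :: 'a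
      have S_comp: "S m c \<circ> S m' c' = S (m + m') (c * c' ^ (p ^ (d * m)))" for m c m' c'
        using w(1) by (auto simp: S_def power_mult_distrib power_add distrib_left mult.commute[of "p ^ (d * m')"]
            simp flip: power_mult)
      have S_0: "S 0 1 = id" using w(1) by (auto simp: S_def)
      have S_1: "x = S 1 1"
        using w(1) b bw by (auto simp: S_def power_divide field_simps)
      have S_pow: "x ^^ m = S m 1" for m
      proof (induction m)
        case (Suc m)
        have "x \<circ> S m 1 = S (Suc m) 1" unfolding S_1 S_comp by simp
        then show ?case by (simp only: funpow.simps Suc)
      qed (simp add: S_0)
      have S_period: "S (r ^ k * m) c = S 0 c" for m c
      proof -
        have "d * (r ^ k * m) = n * m" by (simp add: nk)
        then have "y ^ (p ^ (d * (r ^ k * m))) = y" for y :: 'a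
          by (simp only: power_card_mult)
        then show ?thesis by (simp add: S_def)
      qed
      have S_w: "S m c w = c * w" for m c using w(1) by (simp add: S_def)
      have S_inj: "c = c'" if "S m c = S m' c'" for m c m' c'
        using fun_cong[OF that, of w] w(1) by (simp add: S_w)
      have S_ex: "\<exists>m c. c \<noteq> 0 \<and> h = S m c" if h: "h \<in> R" for h
      proof -
        obtain i where i: "frob_exponent p i h" using semilinear[OF h] by blast
        obtain m where m: "i = d * m" using d(4)[OF h i] by (rule dvdE)
        obtain a where a: "a \<noteq> 0" "h = (\<lambda>v. a * v ^ (p ^ (d * m)))"
          using i unfolding m by (auto simp: frob_exponent_def)
        have "h = S m (a * w ^ (p ^ (d * m)) / w)"
          using w(1) a by (auto simp: S_def power_divide)
        moreover have "a * w ^ (p ^ (d * m)) / w \<noteq> 0" using w(1) a(1) by simp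
        ultimately show ?thesis by blast
      qed
      \<comment> \<open>Composition with a power of \<open>x\<close> completes the exponent to a
        multiple of \<open>r ^ k\<close> and so strips off the automorphism, leaving the
        multiplication by \<open>c\<close>.\<close>
      have S_R: "S 0 c \<in> R" if "S m c \<in> R" for m c
      proof -
        have "S m c \<circ> x ^^ (r ^ k * m - m) = S (m + (r ^ k * m - m)) c"
          by (simp add: S_pow S_comp)
        also have "m + (r ^ k * m - m) = r ^ k * m" using r1 by simp
        finally have "S m c \<circ> x ^^ (r ^ k * m - m) = S 0 c" by (simp only: S_period)
        with comp[OF that powR[OF xR]] show ?thesis by metis
      qed
      have S_order: "c ^ (r ^ e) = 1" if "S m c \<in> R" for m c
      proof -
        have "S 0 c ^^ t = S 0 (c ^ t)" for t
        proof (induction t)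
          case (Suc t)
          have "S 0 c \<circ> S 0 (c ^ t) = S 0 (c ^ Suc t)" unfolding S_comp by simp
          then show ?case by (simp only: funpow.simps Suc)
        qed (simp add: S_0)
        then have "S 0 (c ^ (r ^ e)) = S 0 1" using order[OF S_R[OF that]] by (simp add: S_0)
        then show ?thesis by (rule S_inj)
      qed
      \<comment> \<open>A power of \<open>x\<close> of order \<open>r\<close>. It fixes
        \<open>w\<close> without being the identity, so by \<open>central\<close> some
        \<open>h\<close> in \<open>R\<close> does not commute with it.\<close>
      define z where "z = x ^^ (r ^ (k - 1))"
      have zS: "z = S (r ^ (k - 1)) 1" unfolding z_def by (rule S_pow)
      have zR: "z \<in> R" unfolding z_def using xR by (rule powR)
      have "z \<noteq> id"
      proof
        assume "z = id"
        moreover have "frob_exponent p (r ^ (k - 1) * d) z"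
          unfolding z_def by (rule frob_exponent_funpow[OF \<open>frob_exponent p d x\<close>])
        ultimately have "(r ^ (k - 1) * d) mod n = 0 mod n"
          using frob_exponent_unique frob_exponent_id by metis
        then have "d * r ^ k dvd d * r ^ (k - 1)"
          unfolding nk by (simp add: mod_eq_0_iff_dvd mult.commute)
        then have "r ^ k dvd r ^ (k - 1)" using d(1) by simp
        then have "r ^ k \<le> r ^ (k - 1)" using r1 by (intro dvd_imp_le) simp_all
        moreover have "r ^ (k - 1) < r ^ k" using r1 k0 by (intro power_strict_increasing) simp_all
        ultimately show False by simp
      qed
      moreover have "z w = w" using S_w[of "r ^ (k - 1)" 1] zS by simp
      ultimately obtain h where h: "h \<in> R" "z \<circ> h \<noteq> h \<circ> z"
        using central[OF zR _ w(1)] by blast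
      obtain m c where c: "c \<noteq> 0" "h = S m c" using S_ex[OF h(1)] by blast
      define Y where "Y = p ^ (d * r ^ (k - 1))"
      \<comment> \<open>By \<open>S_comp\<close>, the two products of \<open>z\<close> and
        \<open>S m c\<close> differ only in having \<open>c ^ Y\<close> or \<open>c\<close> as
        coefficient.\<close>
      have cY: "c ^ Y \<noteq> c"
        using h(2) unfolding zS c(2) S_comp by (auto simp: Y_def add.commute)
      have c1: "c \<noteq> 1" using cY by auto
      have ce: "c ^ (r ^ e) = 1" using S_order h(1) c(2) by simp
      \<comment> \<open>A nontrivial \<open>c\<close> of \<open>r\<close>-power order forces
        \<open>r\<close> to divide the order \<open>p ^ n - 1\<close> of the multiplicative group;
        \<open>Fermat_prime_power_cong\<close> then replaces \<open>p ^ n\<close> by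
        \<open>p ^ d\<close>.\<close>
      have "c ^ gcd (r ^ e) (p ^ n - 1) = 1"
        using ce finite_field_power_minus_one[OF c(1)] card by (intro power_gcd_eq_1) simp_all
      then have "gcd (r ^ e) (p ^ n - 1) \<noteq> 1" using c1 by auto
      then have "\<not> coprime r (p ^ n - 1)" by (metis coprime_iff_gcd_eq_1 coprime_power_left_iff)
      then have "r dvd p ^ n - 1" using r(1) by (metis prime_imp_coprime)
      then have q: "[p ^ n = 1] (mod r)"
        using prime_gt_0_nat[OF p] by (subst cong_altdef_nat) simp_all
      have "p ^ n = (p ^ d) ^ (r ^ k)" by (simp add: nk power_mult)
      then have q0: "[p ^ d = 1] (mod r)"
        using q Fermat_prime_power_cong[OF r(1), of "p ^ d" k] by (metis cong_sym cong_trans)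
      \<comment> \<open>\<open>Y\<close> is an \<open>r ^ (k - 1)\<close>-th power of
        \<open>p ^ d\<close>, hence congruent to 1 modulo \<open>r ^ k\<close>. So
        \<open>c ^ (r ^ k) = 1\<close> would give \<open>c ^ Y = c\<close>.\<close>
      have crk: "c ^ (r ^ k) \<noteq> 1"
      proof
        assume "c ^ (r ^ k) = 1"
        have "[(p ^ d) ^ (r ^ (k - 1)) = 1] (mod r ^ Suc (k - 1))"
          by (rule power_prime_power_cong_1[OF r(1) q0])
        moreover have "Y \<ge> 1" using prime_gt_0_nat[OF p] by (simp add: Y_def)
        ultimately have "r ^ k dvd Y - 1"
          using k0 cong_altdef_nat[of 1 Y "r ^ k"] by (simp add: Y_def power_mult)
        then obtain s where "Y - 1 = r ^ k * s" by (rule dvdE)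
        with \<open>Y \<ge> 1\<close> have "Y = 1 + r ^ k * s" by simp
        then have "c ^ Y = c" using \<open>c ^ (r ^ k) = 1\<close> by (simp add: power_mult power_add)
        with cY show False ..
      qed
      \<comment> \<open>Properness is witnessed by \<open>S 0 c\<close>, the multiplication part of
        the \<open>h\<close> that fails to commute with \<open>z\<close>.\<close>
      let ?B = "{h \<in> R. \<exists>m c. c ^ (r ^ k) = 1 \<and> h = S m c}"
      have "S 0 c \<in> R" using S_R h(1) c(2) by simp
      moreover have "S 0 c \<notin> ?B" using S_inj crk by blast
      ultimately have "?B \<subset> R" by blast
      moreover have "id \<in> ?B" using id by (auto intro!: exI[of _ 0] exI[of _ "1::'a"] simp: S_0)
      moreover have "g \<circ> h \<in> ?B" if gh: "g \<in> ?B" "h \<in> ?B" for g h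
      proof -
        obtain m a m' a' where a: "g = S m a" "h = S m' a'" "a ^ (r ^ k) = 1" "a' ^ (r ^ k) = 1"
          using gh by blast
        have "(a * a' ^ (p ^ (d * m))) ^ (r ^ k) = a ^ (r ^ k) * (a' ^ (r ^ k)) ^ (p ^ (d * m))"
          by (simp add: power_mult_distrib mult.commute flip: power_mult)
        also have "\<dots> = 1" using a by simp
        finally have "(a * a' ^ (p ^ (d * m))) ^ (r ^ k) = 1" .
        moreover have "g \<circ> h = S (m + m') (a * a' ^ (p ^ (d * m)))" unfolding a(1,2) by (rule S_comp)
        moreover have "g \<circ> h \<in> R" using gh comp by simp
        ultimately show ?thesis by blast
      qed
      moreover have "fixing_elements R \<subseteq> ?B"
      proof
        fix g assume g: "g \<in> fixing_elements R"
        then have gR: "g \<in> R" by (simp add: fixing_elements_def)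
        obtain v where v: "v \<noteq> 0" "g v = v" using g by (auto simp: fixing_elements_def)
        obtain m a where a: "a \<noteq> 0" "g = S m a" using S_ex[OF gR] by blast
        \<comment> \<open>Dividing \<open>g v = v\<close> by \<open>w\<close> gives the fixed-point
          equation of \<open>norm_one_power\<close> with \<open>u = v / w\<close> and
          \<open>y = p ^ (d * m)\<close>.\<close>
        have "a ^ (r ^ k) = 1"
        proof (rule norm_one_power[OF r])
          show "[p ^ (d * m) = 1] (mod r)" using cong_pow[OF q0, of m] by (simp add: power_mult)
          show "v / w \<noteq> 0" using v(1) w(1) by simp
          show "a * (v / w) ^ (p ^ (d * m)) = v / w"
            using v(2) w(1) unfolding a(2) S_def by (simp add: field_simps)
          have "(p ^ (d * m)) ^ (r ^ k) = p ^ (n * m)" by (simp add: nk mult_ac flip: power_mult)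
          then show "(v / w) ^ ((p ^ (d * m)) ^ (r ^ k)) = v / w"
            by (simp only: power_card_mult)
          show "a ^ (r ^ e) = 1" using S_order gR a(2) by simp
        qed
        then show "g \<in> ?B" using gR a(2) by blast
      qed
      ultimately show thesis by (rule that)
    qed
  qed
qed

end

section \<open>Primitive affine semilinear groups\<close>

lemma perm_group_pow:
  assumes "bij x" shows "x [^]\<^bsub>perm_group S\<^esub> (n::nat) = x ^^ n"
proof (induction n)
  case (Suc n)
  have "bij (x ^^ n)" using assms by (induction n) (auto simp: bij_comp)
  then have "x ^^ n \<otimes>\<^bsub>BijGroup UNIV\<^esub> x = x ^^ n \<circ> x" using assms by (rule mult_BijGroup_UNIV)
  moreover have "x ^^ n \<circ> x = x ^^ Suc n" by (simp only: funpow_Suc_right)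
  ultimately show ?case using Suc by simp
qed simp

lemma GammaL1_add:
  assumes "h \<in> GammaL1" shows "h (x + y) = h x + h y"
  using assms by (auto simp: GammaL1_def field_automorphism_def algebra_simps)

context
  fixes p f :: nat and G H :: "('a::finite_field \<Rightarrow> 'a) set"
  assumes p: "Factorial_Ring.prime p" and card: "card (UNIV :: 'a set) = p ^ f"
    and G: "subgroup G (perm_group AGammaL1)"
    and T: "translation_maps \<subseteq> G"
    and prim: "primitive_action (perm_group G) UNIV id"
    and H_def: "H = stabilizer (perm_group G) id 0"
begin

lemma subgroup_G: "subgroup G (BijGroup UNIV)"
  using group.incl_subgroup[OF group_BijGroup subgroup_AGammaL1 G] .

lemma H_eq: "H = {g \<in> G. g 0 = 0}"
  by (simp add: H_def stabilizer_def)

lemma bij_G: "g \<in> G \<Longrightarrow> bij g"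
  using subgroup.subset[OF subgroup_G] by auto

lemma group_G: "group (perm_group G)"
  using subgroup.subgroup_is_group[OF subgroup_G group_BijGroup] .

lemma comp_G: "g \<in> G \<Longrightarrow> h \<in> G \<Longrightarrow> g \<circ> h \<in> G"
  using subgroup.m_closed[OF subgroup_G] bij_G by (simp add: mult_BijGroup_UNIV)

lemma mult_G: "g \<in> G \<Longrightarrow> h \<in> G \<Longrightarrow> g \<otimes>\<^bsub>perm_group S\<^esub> h = g \<circ> h"
  using bij_G by (simp add: mult_BijGroup_UNIV)

lemma subgroup_H: "subgroup H (perm_group G)"
proof (rule group.finite_closed_subset_subgroup[OF group_G])
  have "id \<in> G" using subgroup.one_closed[OF subgroup_G] by simp
  then show "H \<noteq> {}" by (auto simp: H_eq)
qed (auto simp: H_eq mult_BijGroup_UNIV bij_G comp_G)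

lemma subgroup_H_Bij: "subgroup H (BijGroup UNIV)"
  using group.incl_subgroup[OF group_BijGroup subgroup_G subgroup_H] .

lemma group_H: "group (perm_group H)"
  using subgroup.subgroup_is_group[OF subgroup_H_Bij group_BijGroup] .

lemma H_G: "h \<in> H \<Longrightarrow> h \<in> G" by (simp add: H_eq)

lemma H_0: "h \<in> H \<Longrightarrow> h 0 = 0" by (simp add: H_eq)

lemma translation_G: "(\<lambda>x. x + b) \<in> G"
  using T by (auto simp: translation_maps_def)

lemma affine_G: "h \<in> H \<Longrightarrow> (\<lambda>x. h x + b) \<in> G"
  using comp_G[OF translation_G H_G, of h b] by (simp add: o_def)

lemma G_affine:
  assumes "g \<in> G" obtains h b where "h \<in> H" "g = (\<lambda>x. h x + b)"
proof -
  have "(\<lambda>x. x + (- g 0)) \<circ> g \<in> G" by (rule comp_G[OF translation_G assms])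
  then have "(\<lambda>x. g x - g 0) \<in> H" by (simp add: H_eq o_def)
  then show thesis by (rule that[of _ "g 0"]) simp
qed

lemma H_GammaL1: assumes "h \<in> H" shows "h \<in> GammaL1"
proof -
  have "h \<in> AGammaL1" using subgroup.subset[OF G] H_G[OF assms] by auto
  then have "h \<in> stabilizer (perm_group AGammaL1) id 0"
    using H_0[OF assms] by (simp add: stabilizer_def)
  then show ?thesis by (simp add: stabilizer_AGammaL1)
qed

lemma H_add: "h \<in> H \<Longrightarrow> h (x + y) = h x + h y"
  by (rule GammaL1_add[OF H_GammaL1])

lemma H_diff: "h \<in> H \<Longrightarrow> h (x - y) = h x - h y"
  using H_add[of h "x - y" y] by simp

text \<open>An invariant additive subgroup \<open>W\<close> is a block: \<open>g\<close> with linear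
  part \<open>h\<close> and translation part \<open>b\<close> sends it to the coset
  \<open>W + b\<close>, which equals \<open>W\<close> or is disjoint from it. Primitivity leaves
  only the trivial blocks.\<close>

lemma irreducible:
  assumes W: "0 \<in> W" "\<And>x y. x \<in> W \<Longrightarrow> y \<in> W \<Longrightarrow> x - y \<in> W"
    and inv: "\<And>h x. h \<in> H \<Longrightarrow> x \<in> W \<Longrightarrow> h x \<in> W"
  shows "W = {0} \<or> W = UNIV"
proof -
  have add: "x + y \<in> W" if "x \<in> W" "y \<in> W" for x y
    using W(2)[OF that(1) W(2)[OF W(1) that(2)]] by simp
  have "g ` W = W \<or> g ` W \<inter> W = {}" if g: "g \<in> G" for g
  proof -
    obtain h b where hb: "h \<in> H" "g = (\<lambda>x. h x + b)" using G_affine[OF g] .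
    show ?thesis
    proof (cases "b \<in> W")
      case True
      have "g ` W \<subseteq> W" using hb inv add True by auto
      moreover have "inj_on g W" using bij_G[OF g] by (auto intro: inj_on_subset bij_is_inj)
      ultimately have "g ` W = W" by (intro endo_inj_surj) auto
      then show ?thesis ..
    next
      case False
      have "g x \<notin> W" if "x \<in> W" for x
      proof
        assume "g x \<in> W"
        then have "g x - h x \<in> W" using W(2) inv hb(1) that by blast
        with False show False by (simp add: hb(2))
      qed
      then show ?thesis by blast
    qed
  qed
  then have "action_block (perm_group G) UNIV id W"
    using W(1) unfolding action_block_def by auto
  then have "is_singleton W \<or> W = UNIV"
    using primitive_action.trivial_blocks[OF prim] by blast
  then show ?thesis using W(1) by (auto elim!: is_singletonE)
qed

lemma central_fixes_imp_id:
  assumes z: "z \<in> H" "\<And>h. h \<in> H \<Longrightarrow> z \<circ> h = h \<circ> z" and v: "v \<noteq> 0" "z v = v"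
  shows "z = id"
proof -
  let ?W = "{x. z x = x}"
  have "h x \<in> ?W" if "h \<in> H" "x \<in> ?W" for h x
    using fun_cong[OF z(2)[OF that(1)], of x] that(2) by simp
  then have "?W = {0} \<or> ?W = UNIV"
    using H_0[OF z(1)] H_diff[OF z(1)] by (intro irreducible) auto
  then have "?W = UNIV" using v by auto
  then show ?thesis by (auto simp: fun_eq_iff)
qed

text \<open>With \<open>B\<close> from \<open>fixing_elements_in_proper_submonoid\<close>, the
  product of \<open>B\<close> and \<open>K\<close> contains \<open>fixing_elements H\<close>. The
  order of \<open>B\<close> is a smaller power of \<open>r\<close> than that of \<open>R\<close>, so
  \<open>r\<close> times the order of any subgroup of this product divides
  \<open>card H\<close>.\<close>

lemma dvd_index_fixing_elements:
  assumes nil: "nilpotent_group (perm_group H)"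
    and r: "Factorial_Ring.prime r" "r > 2" "r dvd card H"
  shows "r dvd card (rcosets\<^bsub>perm_group H\<^esub> (generate (perm_group H) (fixing_elements H)))"
proof -
  interpret Hg: group "perm_group H" by (rule group_H)
  have mult: "x \<otimes>\<^bsub>perm_group H\<^esub> y = x \<circ> y" if "x \<in> H" "y \<in> H" for x y
    by (rule mult_G[OF H_G[OF that(1)] H_G[OF that(2)]])
  have pow: "x [^]\<^bsub>perm_group H\<^esub> (k::nat) = x ^^ k" if "x \<in> H" for x k
    using perm_group_pow bij_G[OF H_G[OF that]] by blast
  have finH: "finite (carrier (perm_group H))" by simp
  obtain R K where R: "subgroup R (perm_group H)" and K: "subgroup K (perm_group H)"
    and cardR: "card R = r ^ multiplicity r (Coset.order (perm_group H))"
    and H: "carrier (perm_group H) = R <#>\<^bsub>perm_group H\<^esub> K"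
    and Int: "R \<inter> K = {\<one>\<^bsub>perm_group H\<^esub>}" and cop: "coprime (card R) (card K)"
    and comm: "\<And>x y. x \<in> R \<Longrightarrow> y \<in> K \<Longrightarrow> x \<otimes>\<^bsub>perm_group H\<^esub> y = y \<otimes>\<^bsub>perm_group H\<^esub> x"
    by (rule Hg.nilpotent_Sylow_complement[OF nil finH r(1)]) blast
  have RH: "R \<subseteq> H" and KH: "K \<subseteq> H" using subgroup.subset[OF R] subgroup.subset[OF K] by simp_all
  define e where "e = multiplicity r (Coset.order (perm_group H))"
  have cardR: "card R = r ^ e" using cardR by (simp add: e_def)
  have H0: "card H \<noteq> 0" using subgroup.one_closed[OF subgroup_H] by auto
  have "e > 0" unfolding e_def Coset.order_def using r H0
    by (simp add: prime_multiplicity_gt_zero_iff)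
  have idR: "id \<in> R" using subgroup.one_closed[OF R] by simp
  have compR: "g \<circ> h \<in> R" if "g \<in> R" "h \<in> R" for g h
    using subgroup.m_closed[OF R that] that RH by (simp only: mult subset_iff)
  have decomp: "\<exists>y\<in>R. \<exists>z\<in>K. h = y \<circ> z" if "h \<in> H" for h
  proof -
    have "h \<in> R <#>\<^bsub>perm_group H\<^esub> K" using that H by simp
    then obtain y z where "y \<in> R" "z \<in> K" "h = y \<otimes>\<^bsub>perm_group H\<^esub> z" by (auto simp only: set_mult_def)
    then show ?thesis using RH KH mult by (metis subset_iff)
  qed
  have powR: "h ^^ (r ^ e) = id" if "h \<in> R" for h
    using Hg.subgroup_pow_card[OF R finH that] pow[of h "r ^ e"] that RH cardR by auto
  \<comment> \<open>An element central in \<open>R\<close> is central in \<open>H\<close>, because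
    \<open>R\<close> and \<open>K\<close> commute elementwise; so
    \<open>central_fixes_imp_id\<close> applies.\<close>
  have central: "z = id" if z: "z \<in> R" "\<And>h. h \<in> R \<Longrightarrow> z \<circ> h = h \<circ> z" and v: "v \<noteq> 0" "z v = v" for z v
  proof (rule central_fixes_imp_id[where v = v])
    show "v \<noteq> 0" "z v = v" by (fact v)+
    show "z \<in> H" using z(1) RH by blast
    fix h assume "h \<in> H"
    then obtain a b where ab: "a \<in> R" "b \<in> K" "h = a \<circ> b" using decomp by blast
    have zb: "z \<circ> b = b \<circ> z" using comm[OF z(1) ab(2)] z(1) ab(2) RH KH mult by (metis subset_iff)
    have "z \<circ> h = a \<circ> (z \<circ> b)" using z(2)[OF ab(1)] by (simp only: ab(3) o_assoc)
    also have "\<dots> = h \<circ> z" by (simp only: zb ab(3) o_assoc)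
    finally show "z \<circ> h = h \<circ> z" .
  qed
  have "R \<noteq> {id}"
  proof
    assume "R = {id}"
    then have "r ^ e = 1" using cardR by simp
    then show False using \<open>e > 0\<close> r(2) by simp
  qed
  have semi: "\<exists>i. frob_exponent p i h" if "h \<in> R" for h
    using GammaL1_Frobenius[OF p card H_GammaL1] that RH unfolding frob_exponent_def by blast
  obtain B where B: "B \<subset> R" "id \<in> B" "\<And>g h. g \<in> B \<Longrightarrow> h \<in> B \<Longrightarrow> g \<circ> h \<in> B"
    and fixB: "fixing_elements R \<subseteq> B"
    by (rule fixing_elements_in_proper_submonoid[OF p card r(1,2) idR compR semi powR central \<open>R \<noteq> {id}\<close>]) blast+
  have BH: "B \<subseteq> H" using B(1) RH by blast
  have sgB: "subgroup B (perm_group H)"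
    using Hg.finite_closed_subset_subgroup[OF finH] BH B mult by (auto simp: subset_iff)
  let ?M = "B <#>\<^bsub>perm_group H\<^esub> K"
  have M: "subgroup ?M (perm_group H)"
    using Hg.commuting_subgroups_product[OF sgB K] comm B(1) by blast
  have "B \<inter> K = {\<one>\<^bsub>perm_group H\<^esub>}" using Int B(1,2) by auto
  then have cardM: "card ?M = card B * card K" by (rule Hg.card_set_mult_trivial_Int[OF sgB K])
  have cardH: "card H = card R * card K"
    using Hg.card_set_mult_trivial_Int[OF R K Int] H by simp
  have K0: "card K > 0" using cardH H0 by (cases "card K") auto
  \<comment> \<open>Raising \<open>h\<close> to the power \<open>card K\<close> kills its
    \<open>K\<close>-component, so \<open>y ^^ card K\<close> fixes \<open>v\<close>. By coprimality
    \<open>y\<close> is a power of this map and fixes \<open>v\<close> as well.\<close>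
  have fixM: "fixing_elements H \<subseteq> ?M"
  proof
    fix h assume h: "h \<in> fixing_elements H"
    then obtain v where v: "v \<noteq> 0" "h v = v" "h \<in> H" by (auto simp: fixing_elements_def)
    obtain y z where yz: "y \<in> R" "z \<in> K" "h = y \<circ> z" using decomp[OF v(3)] by blast
    have c: "y \<in> H" "z \<in> H" using yz RH KH by auto
    have hyz: "h = y \<otimes>\<^bsub>perm_group H\<^esub> z" using yz(3) mult[OF c] by simp
    have "h [^]\<^bsub>perm_group H\<^esub> card K = y [^]\<^bsub>perm_group H\<^esub> card K \<otimes>\<^bsub>perm_group H\<^esub> z [^]\<^bsub>perm_group H\<^esub> card K"
      unfolding hyz using comm[OF yz(1,2)] c by (intro Hg.pow_mult_distrib) simp_all
    also have "z [^]\<^bsub>perm_group H\<^esub> card K = \<one>\<^bsub>perm_group H\<^esub>" by (rule Hg.subgroup_pow_card[OF K finH yz(2)])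
    also have "y [^]\<^bsub>perm_group H\<^esub> card K \<otimes>\<^bsub>perm_group H\<^esub> \<one>\<^bsub>perm_group H\<^esub> = y [^]\<^bsub>perm_group H\<^esub> card K"
      using c by (intro Hg.r_one Hg.nat_pow_closed) simp
    finally have hy: "h ^^ card K = y ^^ card K" using pow v(3) c by simp
    have "(h ^^ k) v = v" for k using v(2) by (induction k) auto
    then have yv: "(y ^^ card K) v = v" by (simp flip: hy)
    have "coprime (card K) (r ^ e)" using cop cardR by (simp add: coprime_commute)
    then obtain s t where st: "card K * s = r ^ e * t + 1"
      using bezout_nat[of "card K" "r ^ e"] K0 by (metis coprime_imp_gcd_eq_1 neq0_conv)
    have "y ^^ (card K * s) = (y ^^ (r ^ e * t)) \<circ> y" unfolding st funpow_add by simp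
    also have "y ^^ (r ^ e * t) = id"
      by (simp add: powR[OF yz(1)] flip: funpow_mult)
    finally have "y = (y ^^ card K) ^^ s" by (simp add: funpow_mult mult.commute)
    moreover have "((y ^^ card K) ^^ s) v = v" using yv by (induction s) auto
    ultimately have "y v = v" by simp
    then have "y \<in> B" using fixB v(1) yz(1) by (auto simp: fixing_elements_def)
    then show "h \<in> ?M" unfolding hyz set_mult_def using yz(2) by blast
  qed
  let ?N = "generate (perm_group H) (fixing_elements H)"
  have fixH: "fixing_elements H \<subseteq> carrier (perm_group H)" by (auto simp: fixing_elements_def)
  have N: "subgroup ?N (perm_group H)" by (rule Hg.generate_is_subgroup[OF fixH])
  have NM: "?N \<subseteq> ?M" by (rule Hg.generate_subgroup_incl[OF fixM M])
  have NMdvd: "card ?N dvd card ?M"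
    by (rule Hg.card_subgroup_dvd[OF N M NM])
  have "card B dvd card R" using Hg.card_subgroup_dvd[OF sgB R] B(1) by blast
  then obtain l where l: "l \<le> e" "card B = r ^ l" using divides_primepow_nat[OF r(1)] cardR by metis
  have "card B < card R" using B(1) by (intro psubset_card_mono) auto
  then have "l < e" using l cardR r(2) by (metis nat_neq_iff order.strict_iff_order)
  then have "r ^ Suc l dvd r ^ e" by (intro le_imp_power_dvd) simp
  then have "r * card B dvd card R" using l cardR by simp
  then have "r * card ?M dvd card H" unfolding cardM cardH by (simp add: mult.assoc[symmetric])
  then have "r * card ?N dvd card H" using NMdvd by (meson dvd_refl dvd_trans mult_dvd_mono)
  moreover have "card (rcosets\<^bsub>perm_group H\<^esub> ?N) * card ?N = card H"
    using Hg.lagrange[OF N] by (simp add: Coset.order_def)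
  ultimately have "r * card ?N dvd card (rcosets\<^bsub>perm_group H\<^esub> ?N) * card ?N" by metis
  moreover have "card ?N \<noteq> 0" using \<open>card (rcosets\<^bsub>perm_group H\<^esub> ?N) * card ?N = card H\<close> H0 by auto
  ultimately show ?thesis by simp
qed

section \<open>A normal covering of \<open>G\<close> with two components\<close>

lemma normal_covering_number_eq_2:
  assumes N: "subgroup N (perm_group H)" "N \<noteq> H" and fixN: "fixing_elements H \<subseteq> N"
  shows "normal_covering_number (perm_group G) = 2"
proof -
  interpret Gg: group "perm_group G" by (rule group_G)
  have finG: "finite (carrier (perm_group G))" by simp
  have NH: "N \<subseteq> H" using subgroup.subset[OF N(1)] by simp
  \<comment> \<open>The preimage of \<open>N\<close> under taking linear parts. It is proper because
    its elements fixing 0 are exactly those of \<open>N\<close>.\<close>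
  define L where "L = {\<lambda>x. h x + b | h b. h \<in> N}"
  have LG: "L \<subseteq> G" using affine_G NH by (auto simp: L_def)
  have idN: "id \<in> N" using subgroup.one_closed[OF N(1)] by simp
  have L: "subgroup L (perm_group G)"
  proof (rule Gg.finite_closed_subset_subgroup[OF finG])
    show "L \<subseteq> carrier (perm_group G)" using LG by simp
    show "L \<noteq> {}" using idN by (auto simp: L_def)
    fix x y assume xy: "x \<in> L" "y \<in> L"
    then obtain g b h c where gh: "g \<in> N" "x = (\<lambda>t. g t + b)" "h \<in> N" "y = (\<lambda>t. h t + c)"
      by (auto simp: L_def)
    have gH: "g \<in> H" "h \<in> H" using gh NH by auto
    have "g \<circ> h \<in> N"
      using subgroup.m_closed[OF N(1) gh(1,3)] mult_G[OF H_G H_G, OF gH] by metis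
    moreover have "x \<circ> y = (\<lambda>t. (g \<circ> h) t + (g c + b))"
      using H_add[OF gH(1)] by (auto simp: gh)
    ultimately have "x \<circ> y \<in> L" unfolding L_def by blast
    moreover have "x \<otimes>\<^bsub>perm_group G\<^esub> y = x \<circ> y" using xy LG by (intro mult_G) auto
    ultimately show "x \<otimes>\<^bsub>perm_group G\<^esub> y \<in> L" by metis
  qed
  have L_proper: "L \<noteq> G"
  proof
    assume "L = G"
    have "H \<subseteq> N"
    proof
      fix h assume h: "h \<in> H"
      then have "h \<in> L" using H_G \<open>L = G\<close> by blast
      then obtain g b where gb: "g \<in> N" "h = (\<lambda>t. g t + b)" by (auto simp: L_def)
      then have "b = 0" using H_0[OF h] H_0[of g] NH by auto
      then show "h \<in> N" using gb by simp
    qed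
    with N(2) NH show False by blast
  qed
  have H_proper: "H \<noteq> G"
    using translation_G[of 1] H_0[of "\<lambda>x. x + 1"] by auto
  define K where "K i = (if i = (0::nat) then H else L)" for i
  have K: "subgroup (K i) (perm_group G) \<and> K i \<noteq> carrier (perm_group G)" for i
    using L L_proper H_proper subgroup_H by (simp add: K_def)
  have conj_subset: "inv\<^bsub>perm_group G\<^esub> x <#\<^bsub>perm_group G\<^esub> K i #>\<^bsub>perm_group G\<^esub> x \<subseteq> carrier (perm_group G)"
    if "x \<in> carrier (perm_group G)" for x i
    using subgroup.subset[OF conjunct1[OF K[of i]]] that
    by (intro Gg.r_coset_subset_G Gg.l_coset_subset_G Gg.inv_closed)
  have cov: "\<exists>i<2. \<exists>x\<in>carrier (perm_group G).
      g \<in> inv\<^bsub>perm_group G\<^esub> x <#\<^bsub>perm_group G\<^esub> K i #>\<^bsub>perm_group G\<^esub> x"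
    if g: "g \<in> G" for g
  proof -
    obtain h b where hb: "h \<in> H" "g = (\<lambda>x. h x + b)" using G_affine[OF g] .
    show ?thesis
    proof (cases "h \<in> fixing_elements H")
      case True
      then have "g \<in> L" using fixN hb(2) unfolding L_def by blast
      then have gK: "g \<in> K 1" by (simp add: K_def)
      have gG: "g \<in> carrier (perm_group G)" using g by simp
      have "g = inv\<^bsub>perm_group G\<^esub> \<one>\<^bsub>perm_group G\<^esub> \<otimes>\<^bsub>perm_group G\<^esub> g \<otimes>\<^bsub>perm_group G\<^esub> \<one>\<^bsub>perm_group G\<^esub>"
        using gG by (simp only: Gg.inv_one Gg.l_one Gg.r_one)
      with gK have "g \<in> inv\<^bsub>perm_group G\<^esub> \<one>\<^bsub>perm_group G\<^esub> <#\<^bsub>perm_group G\<^esub> K 1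
          #>\<^bsub>perm_group G\<^esub> \<one>\<^bsub>perm_group G\<^esub>"
        unfolding l_coset_def r_coset_def by blast
      then show ?thesis using Gg.one_closed by (metis one_less_numeral_iff semiring_norm(76))
    next
      case False
      then have "h v \<noteq> v" if "v \<noteq> 0" for v using hb(1) that by (auto simp: fixing_elements_def)
      \<comment> \<open>The additive map sending \<open>v\<close> to \<open>v - h v\<close> has
        trivial kernel, so on a finite field it is onto; a preimage of \<open>b\<close> is a fixed
        point of \<open>g\<close>.\<close>
      then have "inj (\<lambda>v. v - h v)"
        using H_diff[OF hb(1)] by (intro injI) (metis (no_types, lifting) diff_diff_eq2 diff_add_eq eq_iff_diff_eq_0)
      then have "surj (\<lambda>v. v - h v)" by (rule finite_UNIV_inj_surj[OF finite])
      then obtain c where "b = c - h c" by (metis surjD)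
      then have gc: "g c = c" by (simp add: hb(2))
      \<comment> \<open>This translation moves the fixed point \<open>c\<close> to 0, so conjugation
        by it brings \<open>g\<close> into \<open>H\<close>.\<close>
      define x where "x = (\<lambda>t. t + (- c))"
      have xG: "x \<in> carrier (perm_group G)" unfolding x_def using translation_G[of "- c"] by simp
      have gG: "g \<in> carrier (perm_group G)" using g by simp
      define k where "k = x \<otimes>\<^bsub>perm_group G\<^esub> g \<otimes>\<^bsub>perm_group G\<^esub> inv\<^bsub>perm_group G\<^esub> x"
      have kc: "k \<in> carrier (perm_group G)"
        unfolding k_def by (intro Gg.m_closed Gg.inv_closed xG gG)
      then have kG: "k \<in> G" by simp
      have xG': "x \<in> G" using xG by simp
      have kx: "k \<otimes>\<^bsub>perm_group G\<^esub> x = x \<otimes>\<^bsub>perm_group G\<^esub> g"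
        using xG gG unfolding k_def by (simp only: Gg.m_assoc Gg.l_inv Gg.r_one Gg.m_closed Gg.inv_closed)
      then have "k \<circ> x = x \<circ> g" using mult_G[OF kG xG'] mult_G[OF xG' g] by metis
      then have "k (x c) = x (g c)" by (metis comp_apply)
      then have "k \<in> K 0" using kG gc by (simp add: x_def K_def H_eq)
      moreover have "g = inv\<^bsub>perm_group G\<^esub> x \<otimes>\<^bsub>perm_group G\<^esub> k \<otimes>\<^bsub>perm_group G\<^esub> x"
        using Gg.mult_inv_cancel(2)[OF xG gG] Gg.m_assoc[OF Gg.inv_closed[OF xG] kc xG] kx by metis
      ultimately have "g \<in> inv\<^bsub>perm_group G\<^esub> x <#\<^bsub>perm_group G\<^esub> K 0 #>\<^bsub>perm_group G\<^esub> x"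
        unfolding l_coset_def r_coset_def by blast
      then show ?thesis using xG by (intro exI[of _ 0]) auto
    qed
  qed
  let ?S = "{k::nat. \<exists>K. (\<forall>i<k. subgroup (K i) (perm_group G) \<and> K i \<noteq> carrier (perm_group G)) \<and>
      carrier (perm_group G) = (\<Union>i<k. \<Union>x\<in>carrier (perm_group G).
        inv\<^bsub>perm_group G\<^esub> x <#\<^bsub>perm_group G\<^esub> K i #>\<^bsub>perm_group G\<^esub> x)}"
  have "carrier (perm_group G) = (\<Union>i<2::nat. \<Union>x\<in>carrier (perm_group G).
        inv\<^bsub>perm_group G\<^esub> x <#\<^bsub>perm_group G\<^esub> K i #>\<^bsub>perm_group G\<^esub> x)" (is "_ = ?U")
  proof (rule subset_antisym)
    show "carrier (perm_group G) \<subseteq> ?U"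
    proof
      fix g assume "g \<in> carrier (perm_group G)"
      then have "g \<in> G" by simp
      from cov[OF this] show "g \<in> ?U" by blast
    qed
    show "?U \<subseteq> carrier (perm_group G)" using conj_subset by (intro UN_least)
  qed
  then have two: "(2::nat) \<in> ?S" using K by blast
  \<comment> \<open>No subgroups cover nothing, and a single class is excluded by
    \<open>union_conjugates_neq_carrier\<close>.\<close>
  have ge2: "2 \<le> k" if "k \<in> ?S" for k :: nat
  proof (rule ccontr)
    assume "\<not> 2 \<le> k"
    then have "k = 0 \<or> k = 1" by auto
    obtain K' where K': "\<And>i. i < k \<Longrightarrow> subgroup (K' i) (perm_group G) \<and> K' i \<noteq> carrier (perm_group G)"
      and cov': "carrier (perm_group G) = (\<Union>i<k. \<Union>x\<in>carrier (perm_group G).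
        inv\<^bsub>perm_group G\<^esub> x <#\<^bsub>perm_group G\<^esub> K' i #>\<^bsub>perm_group G\<^esub> x)"
      using \<open>k \<in> ?S\<close> by blast
    show False
    proof (cases "k = 0")
      case True
      then have "carrier (perm_group G) = {}" using cov' by (simp only: lessThan_0 UN_empty)
      then show False using Gg.one_closed by blast
    next
      case False
      then have k: "k = Suc 0" using \<open>k = 0 \<or> k = 1\<close> by simp
      have "{..<Suc 0} = {0}" by auto
      then have "carrier (perm_group G) = (\<Union>x\<in>carrier (perm_group G).
        inv\<^bsub>perm_group G\<^esub> x <#\<^bsub>perm_group G\<^esub> K' 0 #>\<^bsub>perm_group G\<^esub> x)"
        using cov' unfolding k by (simp only: UN_singleton UN_insert UN_empty Un_empty_right)
      then show False using Gg.union_conjugates_neq_carrier[OF finG, of "K' 0"] K'[of 0] k by blast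
    qed
  qed
  have "(INF k\<in>?S. enat k) = enat 2"
  proof (rule antisym)
    show "(INF k\<in>?S. enat k) \<le> enat 2" using two by (rule INF_lower)
    show "enat 2 \<le> (INF k\<in>?S. enat k)" using ge2 by (intro INF_greatest) (simp only: enat_ord_simps)
  qed
  then show ?thesis by (simp only: normal_covering_number_def numeral_eq_enat)
qed

section \<open>The translation group as the unique minimal normal subgroup, and its quotient\<close>

lemma translation_maps_normal: "translation_maps \<lhd> perm_group G"
proof -
  interpret Gg: group "perm_group G" by (rule group_G)
  show ?thesis
  proof (rule Gg.normal_invI)
    show "subgroup translation_maps (perm_group G)"
    proof (rule Gg.finite_closed_subset_subgroup)
      fix x y :: "'a \<Rightarrow> 'a" assume xy: "x \<in> translation_maps" "y \<in> translation_maps"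
      then obtain b c where "x = (\<lambda>t. t + b)" "y = (\<lambda>t. t + c)" by (auto simp: translation_maps_def)
      then have "x \<circ> y = (\<lambda>t. t + (c + b))" by (auto simp: add.assoc)
      then have "x \<circ> y \<in> translation_maps" by (auto simp: translation_maps_def)
      moreover have "x \<otimes>\<^bsub>perm_group G\<^esub> y = x \<circ> y" using xy T by (intro mult_G) auto
      ultimately show "x \<otimes>\<^bsub>perm_group G\<^esub> y \<in> translation_maps" by metis
    qed (use T in \<open>auto simp: translation_maps_def\<close>)
  next
    fix g t assume g: "g \<in> carrier (perm_group G)" and t: "t \<in> (translation_maps :: ('a \<Rightarrow> 'a) set)"
    have gG: "g \<in> G" using g by simp
    obtain h b where hb: "h \<in> H" "g = (\<lambda>x. h x + b)" using G_affine[OF gG] .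
    obtain c where c: "t = (\<lambda>x. x + c)" using t by (auto simp: translation_maps_def)
    have tG: "t \<in> carrier (perm_group G)" "t \<in> G" using t T by auto
    have sG: "(\<lambda>x. x + h c) \<in> G" by (rule translation_G)
    have "g \<circ> t = (\<lambda>x. x + h c) \<circ> g"
      using H_add[OF hb(1)] by (auto simp: hb(2) c algebra_simps)
    then have "g \<otimes>\<^bsub>perm_group G\<^esub> t = (\<lambda>x. x + h c) \<otimes>\<^bsub>perm_group G\<^esub> g"
      using mult_G[OF gG tG(2)] mult_G[OF sG gG] by metis
    moreover have "(\<lambda>x. x + h c) \<in> carrier (perm_group G)" using sG by simp
    ultimately have "g \<otimes>\<^bsub>perm_group G\<^esub> t \<otimes>\<^bsub>perm_group G\<^esub> inv\<^bsub>perm_group G\<^esub> g = (\<lambda>x. x + h c)"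
      using g by (simp only: Gg.m_assoc Gg.r_inv Gg.r_one Gg.inv_closed)
    then show "g \<otimes>\<^bsub>perm_group G\<^esub> t \<otimes>\<^bsub>perm_group G\<^esub> inv\<^bsub>perm_group G\<^esub> g \<in> translation_maps"
      unfolding translation_maps_def by blast
  qed
qed

text \<open>Conjugating the translation by \<open>b\<close> with \<open>h\<close> in
  \<open>H\<close> gives the translation by \<open>h b\<close>. So the vectors whose translations
  lie in \<open>M\<close> form an \<open>H\<close>-invariant subgroup, and
  \<open>irreducible\<close> applies.\<close>

lemma normal_subset_translation_maps:
  assumes M: "M \<lhd> perm_group G" "M \<subseteq> translation_maps"
  shows "M = {id} \<or> M = translation_maps"
proof -
  interpret Gg: group "perm_group G" by (rule group_G)
  interpret M: subgroup M "perm_group G" using M(1) by (rule normal_imp_subgroup)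
  let ?W = "{b. (\<lambda>x. x + b) \<in> M}"
  have MG: "t \<in> G" if "t \<in> M" for t using that M(2) T by blast
  have M_W: "M = (\<lambda>b x. x + b) ` ?W"
    using M(2) by (auto simp: translation_maps_def)
  have id_eq: "(\<lambda>x::'a. x + 0) = id" by auto
  have "?W = {0} \<or> ?W = UNIV"
  proof (rule irreducible)
    show "0 \<in> ?W" using M.one_closed by (simp add: id_def)
  next
    fix b c assume bc: "b \<in> ?W" "c \<in> ?W"
    let ?t = "\<lambda>x. x + c"
    have t: "?t \<in> M" using bc by simp
    have "(\<lambda>x. x + (- c)) \<otimes>\<^bsub>perm_group G\<^esub> ?t = (\<lambda>x. x + (- c)) \<circ> ?t"
      by (rule mult_G[OF translation_G translation_G])
    also have "\<dots> = \<one>\<^bsub>perm_group G\<^esub>" by auto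
    finally have "inv\<^bsub>perm_group G\<^esub> ?t = (\<lambda>x. x + (- c))"
      by (rule Gg.inv_equality) (use translation_G[of c] translation_G[of "- c"] in simp_all)
    then have "(\<lambda>x. x + (- c)) \<in> M" using M.m_inv_closed[OF t] by metis
    then have "(\<lambda>x. x + b) \<otimes>\<^bsub>perm_group G\<^esub> (\<lambda>x. x + (- c)) \<in> M"
      using bc by (intro M.m_closed) simp_all
    moreover have "(\<lambda>x. x + b) \<otimes>\<^bsub>perm_group G\<^esub> (\<lambda>x. x + (- c)) = (\<lambda>x. x + b) \<circ> (\<lambda>x. x + (- c))"
      by (rule mult_G[OF translation_G translation_G])
    moreover have "(\<lambda>x. x + b) \<circ> (\<lambda>x. x + (- c)) = (\<lambda>x. x + (b - c))" by auto
    ultimately have "(\<lambda>x. x + (b - c)) \<in> M" by metis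
    then show "b - c \<in> ?W" by simp
  next
    fix h b assume h: "h \<in> H" and b: "b \<in> ?W"
    let ?t = "\<lambda>x. x + b" and ?s = "\<lambda>x. x + h b"
    have t: "?t \<in> M" using b by simp
    have hc: "h \<in> carrier (perm_group G)" "?s \<in> carrier (perm_group G)"
      using H_G[OF h] translation_G by auto
    have "h \<circ> ?t = ?s \<circ> h" using H_add[OF h] by auto
    then have "h \<otimes>\<^bsub>perm_group G\<^esub> ?t = ?s \<otimes>\<^bsub>perm_group G\<^esub> h"
      using mult_G[OF H_G[OF h] translation_G[of b]] mult_G[OF translation_G[of "h b"] H_G[OF h]] by metis
    then have "h \<otimes>\<^bsub>perm_group G\<^esub> ?t \<otimes>\<^bsub>perm_group G\<^esub> inv\<^bsub>perm_group G\<^esub> h = ?s"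
      using hc by (simp only: Gg.m_assoc Gg.r_inv Gg.r_one Gg.inv_closed)
    moreover have "h \<otimes>\<^bsub>perm_group G\<^esub> ?t \<otimes>\<^bsub>perm_group G\<^esub> inv\<^bsub>perm_group G\<^esub> h \<in> M"
      by (rule Gg.normal_invE(2)[OF M(1) hc(1) t])
    ultimately have "?s \<in> M" by metis
    then show "h b \<in> ?W" by simp
  qed
  then show ?thesis
  proof
    assume "?W = {0}"
    then have "M = {id}" using M_W id_eq by simp
    then show ?thesis ..
  next
    assume "?W = UNIV"
    then have "translation_maps \<subseteq> M" by (auto simp: translation_maps_def)
    then show ?thesis using M(2) by blast
  qed
qed

lemma translation_maps_nontrivial: "translation_maps \<noteq> {id :: 'a \<Rightarrow> 'a}"
proof
  assume "translation_maps = {id :: 'a \<Rightarrow> 'a}"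
  moreover have "(\<lambda>x::'a. x + 1) \<in> translation_maps" by (auto simp: translation_maps_def)
  ultimately have "(\<lambda>x::'a. x + 1) = id" by blast
  from fun_cong[OF this, of 0] show False by simp
qed

lemma minimal_normal_translation_maps: "minimal_normal_subgroup translation_maps (perm_group G)"
  using translation_maps_normal translation_maps_nontrivial normal_subset_translation_maps
  by (simp add: minimal_normal_subgroup_def)

text \<open>If \<open>N\<close> met the translations trivially, commutators of elements of
  \<open>N\<close> with translations, lying in both normal subgroups, would be trivial. An element
  commuting with all translations has identity linear part, as values at 0 show, so \<open>N\<close>
  would consist of translations and be trivial.\<close>

lemma minimal_normal_unique:
  assumes N: "minimal_normal_subgroup N (perm_group G)"
  shows "N = translation_maps"
proof -
  interpret Gg: group "perm_group G" by (rule group_G)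
  have Nn: "N \<lhd> perm_group G" and Nt: "N \<noteq> {id}"
    and Nm: "\<And>M. M \<lhd> perm_group G \<Longrightarrow> M \<subseteq> N \<Longrightarrow> M = {id} \<or> M = N"
    using N by (auto simp: minimal_normal_subgroup_def)
  interpret N: subgroup N "perm_group G" using Nn by (rule normal_imp_subgroup)
  have "N \<inter> translation_maps \<lhd> perm_group G"
    by (rule Gg.normal_subgroup_intersect[OF Nn translation_maps_normal])
  then consider "N \<inter> translation_maps = {id}" | "N \<inter> translation_maps = N"
    using Nm by blast
  then show ?thesis
  proof cases
    case 1
    have "N \<subseteq> translation_maps"
    proof
      fix m assume m: "m \<in> N"
      have mG: "m \<in> carrier (perm_group G)" "m \<in> G" using N.subset m by auto
      obtain h b where hb: "h \<in> H" "m = (\<lambda>x. h x + b)" using G_affine[OF mG(2)] .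
      have "h c = c" for c
      proof -
        let ?t = "\<lambda>x. x + c"
        have tG: "?t \<in> carrier (perm_group G)" "?t \<in> G" using translation_G by auto
        have tT: "?t \<in> translation_maps" by (auto simp: translation_maps_def)
        interpret V: subgroup translation_maps "perm_group G"
          using translation_maps_normal by (rule normal_imp_subgroup)
        let ?c = "m \<otimes>\<^bsub>perm_group G\<^esub> ?t \<otimes>\<^bsub>perm_group G\<^esub> inv\<^bsub>perm_group G\<^esub> m \<otimes>\<^bsub>perm_group G\<^esub> inv\<^bsub>perm_group G\<^esub> ?t"
        have "?c \<in> translation_maps"
          by (intro V.m_closed V.m_inv_closed Gg.normal_invE(2)[OF translation_maps_normal mG(1)] tT)
        moreover have "?t \<otimes>\<^bsub>perm_group G\<^esub> inv\<^bsub>perm_group G\<^esub> m \<otimes>\<^bsub>perm_group G\<^esub> inv\<^bsub>perm_group G\<^esub> ?t \<in> N"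
          by (intro Gg.normal_invE(2)[OF Nn tG(1)] N.m_inv_closed m)
        then have "m \<otimes>\<^bsub>perm_group G\<^esub> (?t \<otimes>\<^bsub>perm_group G\<^esub> inv\<^bsub>perm_group G\<^esub> m \<otimes>\<^bsub>perm_group G\<^esub> inv\<^bsub>perm_group G\<^esub> ?t) \<in> N"
          by (rule N.m_closed[OF m])
        then have cN: "?c \<in> N" using mG(1) tG(1) by (simp only: Gg.m_assoc Gg.m_closed Gg.inv_closed)
        ultimately have "?c \<in> N \<inter> translation_maps" by (intro IntI cN)
        then have "?c = id" unfolding 1 by (rule singletonD)
        then have "?c = \<one>\<^bsub>perm_group G\<^esub>" by simp
        then have "?c \<otimes>\<^bsub>perm_group G\<^esub> (?t \<otimes>\<^bsub>perm_group G\<^esub> m) = ?t \<otimes>\<^bsub>perm_group G\<^esub> m"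
          using mG(1) tG(1) by (simp only: Gg.l_one Gg.m_closed)
        moreover have "?c \<otimes>\<^bsub>perm_group G\<^esub> (?t \<otimes>\<^bsub>perm_group G\<^esub> m) = m \<otimes>\<^bsub>perm_group G\<^esub> ?t"
          using mG(1) tG(1) by (simp only: Gg.m_assoc Gg.mult_inv_cancel Gg.m_closed Gg.inv_closed Gg.l_inv Gg.r_one)
        ultimately have "m \<circ> ?t = ?t \<circ> m"
          using mult_G[OF mG(2) tG(2)] mult_G[OF tG(2) mG(2)] by metis
        from fun_cong[OF this, of 0] show "h c = c" using H_0[OF hb(1)] by (simp add: hb(2) add.commute)
      qed
      then have "m = (\<lambda>x. x + b)" using hb(2) by simp
      then show "m \<in> translation_maps" by (auto simp: translation_maps_def)
    qed
    then have "N = {id}" using 1 by blast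
    with Nt show ?thesis ..
  next
    case 2
    then show ?thesis using normal_subset_translation_maps[OF Nn] Nt by blast
  qed
qed

lemma comm_group_translation_maps: "comm_group ((perm_group G)\<lparr>carrier := translation_maps\<rparr>)"
proof -
  have "group ((perm_group G)\<lparr>carrier := translation_maps\<rparr>)"
    using group.subgroup_imp_group[OF group_G normal_imp_subgroup[OF translation_maps_normal]] .
  then show ?thesis
  proof (rule group.group_comm_groupI)
    fix x y assume "x \<in> carrier ((perm_group G)\<lparr>carrier := translation_maps\<rparr>)"
      "y \<in> carrier ((perm_group G)\<lparr>carrier := translation_maps\<rparr>)"
    then have xy: "x \<in> translation_maps" "y \<in> translation_maps" by simp_all
    then have "bij x" "bij y" using T bij_G by auto
    moreover have "x \<circ> y = y \<circ> x" using xy by (auto simp: translation_maps_def)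
    ultimately show "x \<otimes>\<^bsub>(perm_group G)\<lparr>carrier := translation_maps\<rparr>\<^esub> y =
        y \<otimes>\<^bsub>(perm_group G)\<lparr>carrier := translation_maps\<rparr>\<^esub> x"
      by (simp add: mult_BijGroup_UNIV)
  qed
qed

text \<open>Every coset of the translations contains the linear part of its elements, so
  \<open>H\<close> maps onto the quotient and \<open>nilpotent_image\<close> applies.\<close>

lemma nilpotent_quotient:
  assumes nil: "nilpotent_group (perm_group H)"
  shows "nilpotent_group (perm_group G Mod translation_maps)"
proof -
  interpret Gg: group "perm_group G" by (rule group_G)
  interpret V: normal translation_maps "perm_group G" by (rule translation_maps_normal)
  define \<phi> where "\<phi> = r_coset (perm_group G) translation_maps"
  have hom: "\<phi> \<in> hom (perm_group G) (perm_group G Mod translation_maps)" unfolding \<phi>_def by (rule V.r_coset_hom_Mod)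
  have "\<phi> \<in> hom (perm_group H) (perm_group G Mod translation_maps)"
    using hom H_G unfolding hom_def by auto
  then have gh: "group_hom (perm_group H) (perm_group G Mod translation_maps) \<phi>"
    using group_H V.factorgroup_is_group by (simp add: group_hom_def group_hom_axioms_def)
  have "carrier (perm_group G Mod translation_maps) \<subseteq> \<phi> ` H"
  proof
    fix C assume "C \<in> carrier (perm_group G Mod translation_maps)"
    then obtain g where g: "g \<in> carrier (perm_group G)" "C = \<phi> g" unfolding carrier_FactGroup \<phi>_def by blast
    have gG: "g \<in> G" using g by simp
    obtain h b where hb: "h \<in> H" "g = (\<lambda>x. h x + b)" using G_affine[OF gG] .
    have "(\<lambda>x. x + b) \<otimes>\<^bsub>perm_group G\<^esub> h = (\<lambda>x. x + b) \<circ> h" by (rule mult_G[OF translation_G H_G[OF hb(1)]])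
    also have "\<dots> = g" by (auto simp: hb(2))
    finally have gd: "g = (\<lambda>x. x + b) \<otimes>\<^bsub>perm_group G\<^esub> h" ..
    have "(\<lambda>x. x + b) \<in> translation_maps" by (auto simp: translation_maps_def)
    then have "g \<in> \<phi> h" unfolding \<phi>_def r_coset_def gd by blast
    moreover have "h \<in> carrier (perm_group G)" using H_G[OF hb(1)] by simp
    ultimately have "\<phi> g = \<phi> h" unfolding \<phi>_def by (intro Gg.repr_independence[OF _ _ V.subgroup_axioms, symmetric])
    then show "C \<in> \<phi> ` H" using hb(1) g(2) by blast
  qed
  moreover have "\<phi> ` H \<subseteq> carrier (perm_group G Mod translation_maps)"
    unfolding carrier_FactGroup \<phi>_def using H_G by auto
  ultimately have "\<phi> ` carrier (perm_group H) = carrier (perm_group G Mod translation_maps)" by auto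
  with gh nil show ?thesis by (rule group_hom.nilpotent_image)
qed

end

theorem theorem3p9:
  fixes p f r :: nat and G H :: "('a::finite_field \<Rightarrow> 'a) set"
  assumes "Factorial_Ring.prime p" and "f > 0" and "card (UNIV :: 'a set) = p ^ f"
    and "subgroup G (perm_group AGammaL1)"
    and "translation_maps \<subseteq> G"
    and "primitive_action (perm_group G) UNIV id"
    and "H = stabilizer (perm_group G) id 0"
    and "nilpotent_group (perm_group H)"
    and "Factorial_Ring.prime r" and "r dvd card H" and "\<And>s. Factorial_Ring.prime s \<Longrightarrow> s dvd card H \<Longrightarrow> s \<le> r"
    and "r > 2"
  shows "r dvd card (rcosets\<^bsub>perm_group H\<^esub> (generate (perm_group H) (fixing_elements H)))
    \<and> normal_covering_number (perm_group G) = 2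
    \<and> basic_affine_group (perm_group G)"
proof -
  note primG = assms(1,3-7)
  interpret Hg: group "perm_group H" by (rule group_H[OF primG])
  let ?N = "generate (perm_group H) (fixing_elements H)"
  have fixH: "fixing_elements H \<subseteq> carrier (perm_group H)" by (auto simp: fixing_elements_def)
  have N: "subgroup ?N (perm_group H)" by (rule Hg.generate_is_subgroup[OF fixH])
  have index: "r dvd card (rcosets\<^bsub>perm_group H\<^esub> ?N)"
    using dvd_index_fixing_elements[OF primG assms(8,9,12,10)] .
  \<comment> \<open>The index is divisible by \<open>r\<close>, hence not 1; so \<open>?N\<close> is
    proper and can serve as the subgroup \<open>N\<close> of
    \<open>normal_covering_number_eq_2\<close>.\<close>
  have "?N \<noteq> H"
  proof
    assume NH: "?N = H"
    have "card (rcosets\<^bsub>perm_group H\<^esub> ?N) * card H = 1 * card H"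
      using Hg.lagrange[OF N] NH by (simp add: Coset.order_def)
    moreover have "H \<noteq> {}" using Hg.one_closed by auto
    ultimately have "card (rcosets\<^bsub>perm_group H\<^esub> ?N) = 1" by (simp only: mult_cancel2) auto
    with index assms(12) show False by simp
  qed
  then have covering: "normal_covering_number (perm_group G) = 2"
    using normal_covering_number_eq_2[OF primG N] by (meson generate.incl subsetI)
  have "normal_covering_number (perm_group G Mod translation_maps) \<noteq> 2"
    using nilpotent_quotient[OF primG assms(8)] group.nilpotent_covering_number_neq_2 nilpotent_group_def by blast
  then have "basic_affine_group (perm_group G)"
    unfolding basic_affine_group_def
    using group_G[OF primG] minimal_normal_translation_maps[OF primG] minimal_normal_unique[OF primG]
      comm_group_translation_maps[OF primG] covering by auto
  with index covering show ?thesis by blast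
qed

end
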